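(* Let $G$ be a finite group, $K$ a totally real number field, $V$ an irreducible $KG$-module with a non-degenerate $G$-invariant symmetric bilinear form $F$, and $N\trianglelefteq G$. Let $U$ be an irreducible $KN$-module occurring in $V|_N$ with multiplicity $e$, $I$ the inertia group of $U$ in $G$, $t=[G:I]$, and $G=\bigsqcup_{i=1}^t g_iI$, so that $V|_N\cong\bigoplus_{i=1}^t({}^{g_i}U)^e$ with the ${}^{g_i}U$ pairwise non-isomorphic. Let $V_i$ be the summand of $V|_N$ isomorphic to $({}^{g_i}U)^e$ (its ${}^{g_i}U$-isotypic component) and $F_i=F|_{V_i\times V_i}$. Then $(V|_N,F)=(V_1,F_1)\perp\cdots\perp(V_t,F_t)$ is an orthogonal decomposition, and the forms $F_i$ are non-degenerate and pairwise $K$-isometric.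
   Context: ${}^{g}U$ denotes the conjugate $KN$-module ($U$ with $n$ acting as $g^{-1}ng$); the inertia group is $\{g\in G: {}^gU\cong U\}$. *)

theory Defs
  imports Complex_Main "HOL-Algebra.Left_Coset" "HOL-Library.Function_Algebras"
    "HOL-Library.Disjoint_Sets"
begin

definition number_field :: "'k::field_char_0 itself \<Rightarrow> bool" where
  "number_field _ \<longleftrightarrow>
     (\<exists>B :: 'k set. finite B \<and> module.span (\<lambda>(q::rat) x. of_rat q * x) B = UNIV)"

definition field_embedding :: "('k::field \<Rightarrow> 'l::field) \<Rightarrow> bool" where
  "field_embedding \<sigma> \<longleftrightarrow> \<sigma> 1 = 1 \<and>
     (\<forall>x y. \<sigma> (x + y) = \<sigma> x + \<sigma> y) \<and> (\<forall>x y. \<sigma> (x * y) = \<sigma> x * \<sigma> y)"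

definition totally_real :: "'k::field_char_0 itself \<Rightarrow> bool" where
  "totally_real _ \<longleftrightarrow> (\<forall>\<sigma> :: 'k \<Rightarrow> complex. field_embedding \<sigma> \<longrightarrow> range \<sigma> \<subseteq> \<real>)"

text \<open>A \<open>KG\<close>-module is a subspace \<open>V\<close> of an ambient \<open>K\<close>-vector space with a linear action \<open>\<rho>\<close> of
  \<open>G\<close> on it; the values of \<open>\<rho>\<close> outside \<open>carrier G\<close> and \<open>V\<close> are irrelevant.  So a submodule is just
  another module \<open>W \<subseteq> V\<close> with the same \<open>\<rho>\<close>, and restriction to a subgroup \<open>N\<close> only replaces
  \<open>G\<close> by \<open>G\<lparr>carrier := N\<rparr>\<close>.\<close>

locale group_module = group G + vector_space scale
  for G :: "('g, 'x) monoid_scheme" (structure)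
    and scale :: "'k::field \<Rightarrow> 'v::ab_group_add \<Rightarrow> 'v" +
  fixes V :: "'v set" and \<rho> :: "'g \<Rightarrow> 'v \<Rightarrow> 'v"
  assumes subspace_V: "subspace V"
    and act_closed: "\<lbrakk>g \<in> carrier G; v \<in> V\<rbrakk> \<Longrightarrow> \<rho> g v \<in> V"
    and act_add: "\<lbrakk>g \<in> carrier G; v \<in> V; w \<in> V\<rbrakk> \<Longrightarrow> \<rho> g (v + w) = \<rho> g v + \<rho> g w"
    and act_scale: "\<lbrakk>g \<in> carrier G; v \<in> V\<rbrakk> \<Longrightarrow> \<rho> g (scale c v) = scale c (\<rho> g v)"
    and act_one: "v \<in> V \<Longrightarrow> \<rho> \<one> v = v"
    and act_mult: "\<lbrakk>g \<in> carrier G; h \<in> carrier G; v \<in> V\<rbrakk> \<Longrightarrow> \<rho> (g \<otimes> h) v = \<rho> g (\<rho> h v)"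

definition irreducible_module ::
  "('g, 'x) monoid_scheme \<Rightarrow> ('k::field \<Rightarrow> 'v::ab_group_add \<Rightarrow> 'v) \<Rightarrow> 'v set \<Rightarrow> ('g \<Rightarrow> 'v \<Rightarrow> 'v) \<Rightarrow> bool"
where
  "irreducible_module G s V \<rho> \<longleftrightarrow> group_module G s V \<rho> \<and> V \<noteq> {0} \<and>
     (\<forall>W. W \<subseteq> V \<longrightarrow> group_module G s W \<rho> \<longrightarrow> W = {0} \<or> W = V)"

definition linear_map_on ::
  "('k \<Rightarrow> 'v::ab_group_add \<Rightarrow> 'v) \<Rightarrow> 'v set \<Rightarrow> ('k \<Rightarrow> 'w::ab_group_add \<Rightarrow> 'w) \<Rightarrow> ('v \<Rightarrow> 'w) \<Rightarrow> bool"
where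
  "linear_map_on s V s' f \<longleftrightarrow>
     (\<forall>v\<in>V. \<forall>w\<in>V. f (v + w) = f v + f w) \<and> (\<forall>c. \<forall>v\<in>V. f (s c v) = s' c (f v))"

definition module_isomorphic ::
  "('g, 'x) monoid_scheme \<Rightarrow>
   ('k \<Rightarrow> 'v::ab_group_add \<Rightarrow> 'v) \<Rightarrow> 'v set \<Rightarrow> ('g \<Rightarrow> 'v \<Rightarrow> 'v) \<Rightarrow>
   ('k \<Rightarrow> 'w::ab_group_add \<Rightarrow> 'w) \<Rightarrow> 'w set \<Rightarrow> ('g \<Rightarrow> 'w \<Rightarrow> 'w) \<Rightarrow> bool"
where
  "module_isomorphic G s V \<rho> s' W \<tau> \<longleftrightarrow>
     (\<exists>f. linear_map_on s V s' f \<and> bij_betw f V W \<and>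
          (\<forall>g\<in>carrier G. \<forall>v\<in>V. f (\<rho> g v) = \<tau> g (f v)))"

text \<open>The action on the conjugate module \<open>\<^sup>gU\<close>.\<close>

definition conj_action :: "('g, 'x) monoid_scheme \<Rightarrow> 'g \<Rightarrow> ('g \<Rightarrow> 'u \<Rightarrow> 'u) \<Rightarrow> 'g \<Rightarrow> 'u \<Rightarrow> 'u" where
  "conj_action G g \<tau> = (\<lambda>n. \<tau> (inv\<^bsub>G\<^esub> g \<otimes>\<^bsub>G\<^esub> n \<otimes>\<^bsub>G\<^esub> g))"

definition inertia_group ::
  "('g, 'x) monoid_scheme \<Rightarrow> 'g set \<Rightarrow> ('k \<Rightarrow> 'u::ab_group_add \<Rightarrow> 'u) \<Rightarrow> 'u set \<Rightarrow> ('g \<Rightarrow> 'u \<Rightarrow> 'u) \<Rightarrow> 'g set"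
where
  "inertia_group G N s U \<tau> =
     {g \<in> carrier G. module_isomorphic (G\<lparr>carrier := N\<rparr>) s U (conj_action G g \<tau>) s U \<tau>}"

text \<open>The \<open>e\<close>-fold direct power \<open>U\<^sup>e\<close>: \<open>e\<close>-tuples, encoded as functions on \<open>nat\<close> vanishing from
  \<open>e\<close> on, with componentwise operations.\<close>

definition power_space :: "nat \<Rightarrow> 'u::zero set \<Rightarrow> (nat \<Rightarrow> 'u) set" where
  "power_space e U = {x. (\<forall>j<e. x j \<in> U) \<and> (\<forall>j\<ge>e. x j = 0)}"

definition power_scale :: "('k \<Rightarrow> 'u \<Rightarrow> 'u) \<Rightarrow> 'k \<Rightarrow> (nat \<Rightarrow> 'u) \<Rightarrow> nat \<Rightarrow> 'u" where
  "power_scale s c x = (\<lambda>j. s c (x j))"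

definition power_action :: "nat \<Rightarrow> ('g \<Rightarrow> 'u::zero \<Rightarrow> 'u) \<Rightarrow> 'g \<Rightarrow> (nat \<Rightarrow> 'u) \<Rightarrow> nat \<Rightarrow> 'u" where
  "power_action e \<tau> g x = (\<lambda>j. if j < e then \<tau> g (x j) else 0)"

definition internal_direct_sum ::
  "('k::field \<Rightarrow> 'v::ab_group_add \<Rightarrow> 'v) \<Rightarrow> 'v set \<Rightarrow> 'i set \<Rightarrow> ('i \<Rightarrow> 'v set) \<Rightarrow> bool"
where
  "internal_direct_sum s V J W \<longleftrightarrow> finite J \<and> (\<forall>i\<in>J. module.subspace s (W i)) \<and>
     V = {\<Sum>i\<in>J. x i | x. \<forall>i\<in>J. x i \<in> W i} \<and>
     (\<forall>x. (\<forall>i\<in>J. x i \<in> W i) \<longrightarrow> (\<Sum>i\<in>J. x i) = 0 \<longrightarrow> (\<forall>i\<in>J. x i = 0))"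

text \<open>The multiplicity of the irreducible module \<open>U\<close> in the semisimple module \<open>V\<close>: the number of
  summands isomorphic to \<open>U\<close> in a decomposition of \<open>V\<close> into irreducibles.\<close>

definition has_multiplicity ::
  "('g, 'x) monoid_scheme \<Rightarrow>
   ('k::field \<Rightarrow> 'v::ab_group_add \<Rightarrow> 'v) \<Rightarrow> 'v set \<Rightarrow> ('g \<Rightarrow> 'v \<Rightarrow> 'v) \<Rightarrow>
   ('k \<Rightarrow> 'u::ab_group_add \<Rightarrow> 'u) \<Rightarrow> 'u set \<Rightarrow> ('g \<Rightarrow> 'u \<Rightarrow> 'u) \<Rightarrow> nat \<Rightarrow> bool"
where
  "has_multiplicity G s V \<rho> s' U \<tau> e \<longleftrightarrow>
     (\<exists>(m::nat) W. internal_direct_sum s V {..<m} W \<and>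
        (\<forall>j<m. irreducible_module G s (W j) \<rho>) \<and>
        card {j. j < m \<and> module_isomorphic G s (W j) \<rho> s' U \<tau>} = e)"

definition isotypic_component ::
  "('g, 'x) monoid_scheme \<Rightarrow>
   ('k::field \<Rightarrow> 'v::ab_group_add \<Rightarrow> 'v) \<Rightarrow> 'v set \<Rightarrow> ('g \<Rightarrow> 'v \<Rightarrow> 'v) \<Rightarrow>
   ('k \<Rightarrow> 'u::ab_group_add \<Rightarrow> 'u) \<Rightarrow> 'u set \<Rightarrow> ('g \<Rightarrow> 'u \<Rightarrow> 'u) \<Rightarrow> 'v set"
where
  "isotypic_component G s V \<rho> s' U \<tau> =
     module.span s (\<Union>{W. W \<subseteq> V \<and> group_module G s W \<rho> \<and> module_isomorphic G s W \<rho> s' U \<tau>})"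

text \<open>Restricting a form \<open>F\<close> to a subspace means using it with a smaller \<open>V\<close>.\<close>

definition symmetric_bilinear_form ::
  "('k::field \<Rightarrow> 'v::ab_group_add \<Rightarrow> 'v) \<Rightarrow> 'v set \<Rightarrow> ('v \<Rightarrow> 'v \<Rightarrow> 'k) \<Rightarrow> bool"
where
  "symmetric_bilinear_form s V F \<longleftrightarrow>
     (\<forall>w\<in>V. linear_map_on s V (*) (\<lambda>v. F v w)) \<and>
     (\<forall>v\<in>V. linear_map_on s V (*) (\<lambda>w. F v w)) \<and>
     (\<forall>v\<in>V. \<forall>w\<in>V. F v w = F w v)"

definition invariant_form ::
  "('g, 'x) monoid_scheme \<Rightarrow> 'v set \<Rightarrow> ('g \<Rightarrow> 'v \<Rightarrow> 'v) \<Rightarrow> ('v \<Rightarrow> 'v \<Rightarrow> 'k) \<Rightarrow> bool"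
where
  "invariant_form G V \<rho> F \<longleftrightarrow> (\<forall>g\<in>carrier G. \<forall>v\<in>V. \<forall>w\<in>V. F (\<rho> g v) (\<rho> g w) = F v w)"

definition nondegenerate_form :: "'v::zero set \<Rightarrow> ('v \<Rightarrow> 'v \<Rightarrow> 'k::zero) \<Rightarrow> bool" where
  "nondegenerate_form V F \<longleftrightarrow> (\<forall>v\<in>V. (\<forall>w\<in>V. F v w = 0) \<longrightarrow> v = 0)"

definition orthogonal_decomposition ::
  "('k::field \<Rightarrow> 'v::ab_group_add \<Rightarrow> 'v) \<Rightarrow> 'v set \<Rightarrow> ('v \<Rightarrow> 'v \<Rightarrow> 'k) \<Rightarrow> 'i set \<Rightarrow> ('i \<Rightarrow> 'v set) \<Rightarrow> bool"
where
  "orthogonal_decomposition s V F J W \<longleftrightarrow> internal_direct_sum s V J W \<and>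
     (\<forall>i\<in>J. \<forall>j\<in>J. i \<noteq> j \<longrightarrow> (\<forall>v\<in>W i. \<forall>w\<in>W j. F v w = 0))"

definition isometric ::
  "('k::field \<Rightarrow> 'v::ab_group_add \<Rightarrow> 'v) \<Rightarrow> 'v set \<Rightarrow> ('v \<Rightarrow> 'v \<Rightarrow> 'k) \<Rightarrow>
   ('k \<Rightarrow> 'w::ab_group_add \<Rightarrow> 'w) \<Rightarrow> 'w set \<Rightarrow> ('w \<Rightarrow> 'w \<Rightarrow> 'k) \<Rightarrow> bool"
where
  "isometric s V F s' W F' \<longleftrightarrow>
     (\<exists>f. linear_map_on s V s' f \<and> bij_betw f V W \<and> (\<forall>v\<in>V. \<forall>w\<in>V. F' (f v) (f w) = F v w))"

end

theory Submission
  imports Defs "HOL-Computational_Algebra.Fundamental_Theorem_Algebra"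
begin

text \<open>
  A number field \<open>K\<close> embeds into the complex numbers: the multiplication operators of \<open>K\<close> commute and
  are algebraic over the rationals, so the space of rational-linear maps \<open>K \<rightarrow> \<complex>\<close> contains a common
  eigenvector of them, and its eigenvalues form an embedding.  If \<open>K\<close> is totally real, the embedding
  is real and a sum of squares in \<open>K\<close> vanishes only trivially, hence \<open>V\<close> carries a definite
  \<open>G\<close>-invariant form \<open>B\<close>.

  Let \<open>W\<close> and \<open>X\<close> be irreducible \<open>N\<close>-submodules of \<open>V\<close>.  Representing the functionals
  \<open>F w\<close> on \<open>X\<close> by \<open>B\<close> gives an \<open>N\<close>-map \<open>T : W \<rightarrow> X\<close> with \<open>F w x = B (T w) x\<close>, so by Schur's lemma
  \<open>W\<close> and \<open>X\<close> are \<open>F\<close>-orthogonal unless they are isomorphic.  Thus distinct isotypic components are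
  orthogonal.  An element \<open>h\<close> of \<open>G\<close> maps the \<open>U\<close>-component onto the \<open>\<^sup>hU\<close>-component; hence the
  components of the conjugates of \<open>U\<close> span a \<open>G\<close>-submodule, which is all of \<open>V\<close>, and \<open>G\<close> permutes
  them transitively by isometries of \<open>F\<close>.
\<close>

section \<open>Complex embeddings of number fields\<close>

definition rat_linear :: "('k::field_char_0 \<Rightarrow> complex) \<Rightarrow> bool" where
  "rat_linear \<phi> \<longleftrightarrow> (\<forall>x y. \<phi> (x + y) = \<phi> x + \<phi> y) \<and> (\<forall>q x. \<phi> (of_rat q * x) = of_rat q * \<phi> x)"

lemma rat_linear_sum:
  assumes "rat_linear \<phi>"
  shows "\<phi> (\<Sum>i\<in>A. of_rat (c i) * f i) = (\<Sum>i\<in>A. of_rat (c i) * \<phi> (f i))"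
proof -
  have "\<phi> 0 = 0"
    using assms unfolding rat_linear_def by (metis add_cancel_right_right)
  then show ?thesis
    using assms unfolding rat_linear_def by (induction A rule: infinite_finite_induct) auto
qed

lemma vector_space_rat: "vector_space (\<lambda>(q::rat) (x::'k::field_char_0). of_rat q * x)"
  by unfold_locales (auto simp: algebra_simps of_rat_add of_rat_mult)

text \<open>The powers of \<open>a\<close> lie in a finite-dimensional rational space. If they are
  pairwise distinct, they form an infinite, hence dependent set. Dependence of a set does not see
  repetitions, so two coinciding powers are a separate case, where their difference is the
  relation.\<close>

lemma number_field_algebraic:
  fixes a :: "'k::field_char_0"
  assumes "number_field TYPE('k)"
  obtains p :: "rat poly" where "p \<noteq> 0" "(\<Sum>i\<le>degree p. of_rat (coeff p i) * a ^ i) = 0"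
proof -
  interpret Q: vector_space "\<lambda>(q::rat) (x::'k). of_rat q * x"
    by (rule vector_space_rat)
  obtain B :: "'k set" where B: "finite B" "Q.span B = UNIV"
    using assms unfolding number_field_def by blast
  have "\<exists>n (c :: nat \<Rightarrow> rat). (\<exists>i\<le>n. c i \<noteq> 0) \<and> (\<Sum>i\<le>n. of_rat (c i) * a ^ i) = 0"
  proof (cases "inj (\<lambda>i::nat. a ^ i)")
    case False
    then obtain i j :: nat where ij: "i < j" "a ^ i = a ^ j"
      unfolding inj_def by (metis linorder_neqE_nat)
    let ?c = "\<lambda>k. if k = i then 1 else if k = j then - 1 else 0 :: rat"
    have "(\<Sum>k\<le>j. of_rat (?c k) * a ^ k)
        = (\<Sum>k\<le>j. (if k = i then a ^ i else 0) + (if k = j then - (a ^ j) else 0))"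
      using ij by (intro sum.cong) auto
    also have "\<dots> = 0"
      using ij by (simp add: sum.distrib)
    finally show ?thesis
      using ij by (intro exI[of _ j] exI[of _ ?c]) (auto intro!: exI[of _ i])
  next
    case True
    have "Q.dependent (range (\<lambda>i::nat. a ^ i))"
    proof (rule ccontr)
      assume "Q.independent (range (\<lambda>i::nat. a ^ i))"
      then have "finite (range (\<lambda>i::nat. a ^ i))"
        using Q.independent_span_bound[OF B(1)] B(2) by auto
      then show False
        using True by (simp add: finite_image_iff)
    qed
    then obtain S u where S: "finite S" "S \<subseteq> range (\<lambda>i::nat. a ^ i)"
      and u: "(\<Sum>v\<in>S. of_rat (u v) * v) = 0" "\<exists>v\<in>S. u v \<noteq> 0"
      unfolding Q.dependent_explicit by blast
    obtain T where T: "S = (\<lambda>i::nat. a ^ i) ` T" "finite T"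
      by (metis S finite_subset_image)
    define n where "n = Max (insert 0 T)"
    have n: "T \<subseteq> {..n}"
      using T by (auto simp: n_def)
    let ?c = "\<lambda>i. if i \<in> T then u (a ^ i) else 0"
    have "(\<Sum>i\<le>n. of_rat (?c i) * a ^ i) = (\<Sum>i\<in>T. of_rat (u (a ^ i)) * a ^ i)"
      using n by (intro sum.mono_neutral_cong_right) auto
    also have "\<dots> = (\<Sum>v\<in>S. of_rat (u v) * v)"
      unfolding T using True by (subst sum.reindex) (auto intro: inj_on_subset)
    finally have "(\<Sum>i\<le>n. of_rat (?c i) * a ^ i) = 0"
      using u by simp
    moreover have "\<exists>i\<le>n. ?c i \<noteq> 0"
    proof -
      obtain i where "i \<in> T" "u (a ^ i) \<noteq> 0"
        using u(2) unfolding T(1) by blast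
      then show ?thesis
        using n by (intro exI[of _ i]) auto
    qed
    ultimately show ?thesis
      by - (rule exI[of _ n], rule exI[of _ ?c], rule conjI)
  qed
  then obtain n c where c: "\<exists>i\<le>n. c i \<noteq> (0::rat)" "(\<Sum>i\<le>n. of_rat (c i) * a ^ i) = 0"
    by blast
  define p where "p = (\<Sum>i\<le>n. monom (c i) i)"
  have cp: "coeff p i = (if i \<le> n then c i else 0)" for i
    unfolding p_def by (simp add: coeff_sum)
  have "degree p \<le> n"
    by (intro degree_le) (auto simp: cp)
  moreover have "i \<le> degree p" if "i \<le> n" "c i \<noteq> 0" for i
    using that cp[of i] by (intro le_degree) simp
  ultimately have "(\<Sum>i\<le>degree p. of_rat (coeff p i) * a ^ i) = (\<Sum>i\<le>n. of_rat (c i) * a ^ i)"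
    by (intro sum.mono_neutral_cong_left) (auto simp: cp)
  moreover have "p \<noteq> 0"
    using c(1) cp by (metis coeff_0)
  ultimately show ?thesis
    using c that by metis
qed

text \<open>A complex polynomial \<open>p\<close> acts on functions \<open>\<phi> :: 'k \<Rightarrow> complex\<close> by letting the indeterminate
  be the operator \<open>\<phi> \<mapsto> (\<lambda>x. \<phi> (a * x))\<close>.\<close>

definition poly_operator :: "'k::field \<Rightarrow> complex poly \<Rightarrow> ('k \<Rightarrow> complex) \<Rightarrow> 'k \<Rightarrow> complex" where
  "poly_operator a p \<phi> x = (\<Sum>i\<le>degree p. coeff p i * \<phi> (a ^ i * x))"

text \<open>Substituting an operator for the indeterminate turns multiplication by X - z into the
  operator minus z. The coefficients of the product split the sum into a shifted and a scaled part;
  the top term of the scaled part vanishes since it exceeds the degree of \<open>p\<close>.\<close>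

lemma poly_operator_linear_factor:
  "poly_operator a ([:- z, 1:] * p) \<phi> x = poly_operator a p (\<lambda>x. \<phi> (a * x) - z * \<phi> x) x"
proof (cases "p = 0")
  case True
  then show ?thesis by (simp add: poly_operator_def)
next
  case False
  define n where "n = degree p"
  have d: "degree ([:- z, 1:] * p) = Suc n"
    using False by (subst degree_mult_eq) (auto simp: n_def)
  have c: "coeff ([:- z, 1:] * p) i = (case i of 0 \<Rightarrow> 0 | Suc j \<Rightarrow> coeff p j) - z * coeff p i" for i
    by (simp add: coeff_pCons split: nat.split)
  have "poly_operator a ([:- z, 1:] * p) \<phi> x
      = (\<Sum>i\<le>Suc n. (case i of 0 \<Rightarrow> 0 | Suc j \<Rightarrow> coeff p j) * \<phi> (a ^ i * x))
        - (\<Sum>i\<le>Suc n. z * coeff p i * \<phi> (a ^ i * x))"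
    unfolding poly_operator_def d c by (simp add: algebra_simps sum_subtractf del: sum.atMost_Suc)
  also have "(\<Sum>i\<le>Suc n. (case i of 0 \<Rightarrow> 0 | Suc j \<Rightarrow> coeff p j) * \<phi> (a ^ i * x))
      = (\<Sum>i\<le>n. coeff p i * \<phi> (a ^ i * (a * x)))"
    by (subst sum.atMost_Suc_shift) (simp add: algebra_simps)
  also have "(\<Sum>i\<le>Suc n. z * coeff p i * \<phi> (a ^ i * x)) = (\<Sum>i\<le>n. z * coeff p i * \<phi> (a ^ i * x))"
    by (simp add: n_def coeff_eq_0)
  finally show ?thesis
    unfolding poly_operator_def n_def by (simp add: algebra_simps sum_subtractf)
qed

text \<open>A complex root \<open>z\<close> of \<open>p\<close> is split off. Either
  \<open>\<phi>\<close> is already an eigenvector for \<open>z\<close>, or the operator minus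
  \<open>z\<close> sends it to a nonzero function annihilated by the quotient, which has smaller
  degree. The predicate \<open>P\<close> carries along any property that survives these shifts, so
  that further eigenvalues can be prescribed.\<close>

lemma eigenvector_of_annihilating_poly:
  fixes \<phi> :: "'k::field \<Rightarrow> complex"
  assumes "p \<noteq> 0" "\<And>x. poly_operator a p \<phi> x = 0" "P \<phi>" "\<exists>x. \<phi> x \<noteq> 0"
    and "\<And>\<psi> z. P \<psi> \<Longrightarrow> P (\<lambda>x. \<psi> (a * x) - z * \<psi> x)"
  shows "\<exists>\<psi> z. P \<psi> \<and> (\<exists>x. \<psi> x \<noteq> 0) \<and> (\<forall>x. \<psi> (a * x) = z * \<psi> x)"
  using assms(1-4)
proof (induction "degree p" arbitrary: p \<phi>)
  case 0
  then show ?case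
    by (auto simp: poly_operator_def) (metis leading_coeff_0_iff)
next
  case (Suc n)
  have "\<not> constant (poly p)"
    using Suc.hyps(2) by (simp add: constant_degree)
  then obtain z where "poly p z = 0"
    using fundamental_theorem_of_algebra by blast
  then obtain q where q: "p = [:- z, 1:] * q"
    by (metis dvdE poly_eq_0_iff_dvd)
  have "q \<noteq> 0"
    using Suc.prems q by auto
  then have "degree p = Suc (degree q)"
    unfolding q by (subst degree_mult_eq) auto
  then have dq: "n = degree q"
    using Suc.hyps by simp
  let ?\<psi> = "\<lambda>x. \<phi> (a * x) - z * \<phi> x"
  show ?case
  proof (cases "\<exists>x. ?\<psi> x \<noteq> 0")
    case True
    show ?thesis
    proof (rule Suc.hyps(1)[OF dq \<open>q \<noteq> 0\<close>])
      show "poly_operator a q ?\<psi> x = 0" for x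
        using Suc.prems(2) unfolding q poly_operator_linear_factor .
    qed (use assms(5) Suc.prems(3) True in auto)
  next
    case False
    then show ?thesis
      using Suc.prems(3,4) by auto
  qed
qed

text \<open>Induction on \<open>S\<close>: the annihilating polynomial of a new element
  \<open>a\<close> yields an eigenvector of \<open>a\<close> among the functions that are already
  eigenvectors for the elements of \<open>S\<close>.\<close>

lemma simultaneous_eigenvector:
  fixes S :: "'k::field_char_0 set"
  assumes K: "number_field TYPE('k)" and "finite S"
  shows "\<exists>(\<phi> :: 'k \<Rightarrow> complex) ev. rat_linear \<phi> \<and> (\<exists>x. \<phi> x \<noteq> 0) \<and>
           (\<forall>b\<in>S. \<forall>x. \<phi> (b * x) = ev b * \<phi> x)"
  using assms(2)
proof induction
  case empty
  interpret Q: vector_space "\<lambda>(q::rat) (x::'k). of_rat q * x"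
    by (rule vector_space_rat)
  obtain B where B: "{1::'k} \<subseteq> B" "Q.independent B" "UNIV \<subseteq> Q.span B"
    using Q.maximal_independent_subset_extend[of "{1}" UNIV] by auto
  have sp: "x \<in> Q.span B" for x
    using B(3) by blast
  \<comment> \<open>The coordinate of 1 in a rational basis containing 1 is a rational-linear
    functional with value 1 at 1.\<close>
  let ?\<phi> = "\<lambda>x. of_rat (Q.representation B x 1) :: complex"
  have "rat_linear ?\<phi>"
    unfolding rat_linear_def
    by (simp add: Q.representation_add[OF B(2) sp sp] Q.representation_scale[OF B(2) sp]
        of_rat_add of_rat_mult)
  moreover have "?\<phi> 1 \<noteq> 0"
    using B by (simp add: Q.representation_basis)
  ultimately show ?case
    by blast
next
  case (insert a S)
  then obtain \<phi> :: "'k \<Rightarrow> complex" and ev where \<phi>: "rat_linear \<phi>" "\<exists>x. \<phi> x \<noteq> 0"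
    "\<forall>b\<in>S. \<forall>x. \<phi> (b * x) = ev b * \<phi> x" by blast
  obtain p :: "rat poly" where p: "p \<noteq> 0" "(\<Sum>i\<le>degree p. of_rat (coeff p i) * a ^ i) = 0"
    using number_field_algebraic[OF K] by blast
  \<comment> \<open>The eigenvalues on \<open>S\<close> are kept fixed. Multiplication by
    \<open>a\<close> preserves these conditions because \<open>K\<close> is commutative.\<close>
  define P where
    "P = (\<lambda>\<psi>. rat_linear \<psi> \<and> (\<forall>b\<in>S. \<forall>x. \<psi> (b * x) = ev b * \<psi> x))"
  have "\<exists>\<psi> z. P \<psi> \<and> (\<exists>x. \<psi> x \<noteq> 0) \<and> (\<forall>x. \<psi> (a * x) = z * \<psi> x)"
  proof (rule eigenvector_of_annihilating_poly)
    show "map_poly of_rat p \<noteq> (0 :: complex poly)"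
      using p by (simp add: map_poly_eq_0_iff)
    \<comment> \<open>The coefficients are rational, so they pass through \<open>\<phi>\<close>;
      what remains is \<open>\<phi>\<close> at p(a) * x, which is 0.\<close>
    show "poly_operator a (map_poly of_rat p) \<phi> x = 0" for x
    proof -
      have "poly_operator a (map_poly of_rat p) \<phi> x
          = (\<Sum>i\<le>degree p. of_rat (coeff p i) * \<phi> (a ^ i * x))"
        unfolding poly_operator_def by (simp add: degree_map_poly coeff_map_poly)
      also have "\<dots> = \<phi> (\<Sum>i\<le>degree p. of_rat (coeff p i) * (a ^ i * x))"
        using rat_linear_sum[OF \<phi>(1)] by metis
      also have "(\<Sum>i\<le>degree p. of_rat (coeff p i) * (a ^ i * x))
          = (\<Sum>i\<le>degree p. of_rat (coeff p i) * a ^ i) * x"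
        by (simp add: sum_distrib_right mult.assoc)
      also have "\<phi> \<dots> = 0"
        using p(2) rat_linear_sum[OF \<phi>(1), of "\<lambda>_. 0" "\<lambda>_. 0" "{}"] by simp
      finally show ?thesis .
    qed
    show "P (\<lambda>x. \<psi> (a * x) - z * \<psi> x)" if "P \<psi>" for \<psi> z
    proof -
      have \<psi>: "\<And>x y. \<psi> (x + y) = \<psi> x + \<psi> y" "\<And>q x. \<psi> (of_rat q * x) = of_rat q * \<psi> x"
        "\<And>b x. b \<in> S \<Longrightarrow> \<psi> (b * x) = ev b * \<psi> x"
        using that unfolding P_def rat_linear_def by auto
      show ?thesis
        unfolding P_def rat_linear_def
        using \<psi>
        by (simp add: distrib_left right_diff_distrib mult.left_commute[of a])
    qed
  qed (use \<phi> in \<open>auto simp: P_def\<close>)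
  then obtain \<psi> z where \<psi>: "P \<psi>" "\<exists>x. \<psi> x \<noteq> 0" "\<forall>x. \<psi> (a * x) = z * \<psi> x"
    by blast
  then show ?case
    using insert.hyps unfolding P_def
    by (intro exI[of _ \<psi>] exI[of _ "ev(a := z)"]) auto
qed

text \<open>A common eigenvector \<open>\<phi>\<close> for a finite rational spanning set is one for
  every element of \<open>K\<close> by rational linearity. Its eigenvalue at \<open>a\<close> is the
  quotient of \<open>\<phi> a\<close> by \<open>\<phi> 1\<close>, and this is additive as well as
  multiplicative in \<open>a\<close>.\<close>

lemma number_field_embeds_complex:
  assumes "number_field TYPE('k::field_char_0)"
  obtains \<sigma> :: "'k::field_char_0 \<Rightarrow> complex" where "field_embedding \<sigma>"
proof -
  interpret Q: vector_space "\<lambda>(q::rat) (x::'k). of_rat q * x"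
    by (rule vector_space_rat)
  obtain B :: "'k set" where B: "finite B" "Q.span B = UNIV"
    using assms unfolding number_field_def by blast
  obtain \<phi> :: "'k \<Rightarrow> complex" and ev where \<phi>: "rat_linear \<phi>" "\<exists>x. \<phi> x \<noteq> 0"
    "\<forall>b\<in>B. \<forall>x. \<phi> (b * x) = ev b * \<phi> x"
    using simultaneous_eigenvector[OF assms B(1)] by blast
  have "\<exists>z. \<forall>x. \<phi> (a * x) = z * \<phi> x" for a
  proof -
    have "a \<in> Q.span B"
      using B by simp
    then obtain u where "a = (\<Sum>b\<in>B. of_rat (u b) * b)"
      using Q.span_finite[OF B(1)] by auto
    then have "\<phi> (a * x) = (\<Sum>b\<in>B. of_rat (u b) * ev b) * \<phi> x" for x
      using rat_linear_sum[OF \<phi>(1), of u "\<lambda>b. b * x" B] \<phi>(3)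
      by (simp add: sum_distrib_right mult.assoc)
    then show ?thesis
      by blast
  qed
  then obtain \<sigma> where \<sigma>: "\<And>a x. \<phi> (a * x) = \<sigma> a * \<phi> x"
    by metis
  have \<phi>_eq: "\<phi> a = \<sigma> a * \<phi> 1" for a
    using \<sigma>[of a 1] by simp
  then have nz: "\<phi> 1 \<noteq> 0"
    using \<phi>(2) by force
  have "\<sigma> 1 = 1"
    using \<phi>_eq[of 1] nz by simp
  moreover have "\<sigma> (x + y) = \<sigma> x + \<sigma> y" for x y
  proof -
    have "\<sigma> (x + y) * \<phi> 1 = (\<sigma> x + \<sigma> y) * \<phi> 1"
      using \<phi>(1) unfolding rat_linear_def by (metis \<phi>_eq distrib_right)
    then show ?thesis using nz by simp
  qed
  moreover have "\<sigma> (x * y) = \<sigma> x * \<sigma> y" for x y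
  proof -
    have "\<sigma> (x * y) * \<phi> 1 = \<sigma> x * \<sigma> y * \<phi> 1"
      by (metis \<sigma> \<phi>_eq mult.assoc)
    then show ?thesis using nz by simp
  qed
  ultimately show ?thesis
    using that unfolding field_embedding_def by blast
qed

text \<open>A complex embedding takes real values, so the image of the sum is a sum of nonnegative
  real squares and every \<open>f i\<close> is mapped to 0. A nonzero \<open>f i\<close> would be
  invertible, which forces 1 to be mapped to 0.\<close>

lemma totally_real_sum_squares_eq_0:
  fixes f :: "'i \<Rightarrow> 'k::field_char_0"
  assumes "number_field TYPE('k)" "totally_real TYPE('k)"
    and "finite A" "(\<Sum>i\<in>A. f i * f i) = 0" "i \<in> A"
  shows "f i = 0"
proof -
  obtain \<sigma> :: "'k \<Rightarrow> complex" where \<sigma>: "field_embedding \<sigma>"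
    using number_field_embeds_complex[OF assms(1)] by blast
  then have hom: "\<sigma> 1 = 1" "\<And>x y. \<sigma> (x + y) = \<sigma> x + \<sigma> y" "\<And>x y. \<sigma> (x * y) = \<sigma> x * \<sigma> y"
    unfolding field_embedding_def by auto
  have \<sigma>0: "\<sigma> 0 = 0"
    using hom(2)[of 0 0] by simp
  have "\<sigma> x \<in> \<real>" for x
    using assms(2) \<sigma> unfolding totally_real_def by blast
  then have re: "of_real (Re (\<sigma> x)) = \<sigma> x" for x
    by simp
  have "\<sigma> (\<Sum>i\<in>A. f i * f i) = (\<Sum>i\<in>A. \<sigma> (f i) * \<sigma> (f i))"
    using assms(3) by induction (auto simp: \<sigma>0 hom)
  also have "\<dots> = of_real (\<Sum>i\<in>A. Re (\<sigma> (f i)) * Re (\<sigma> (f i)))"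
    using re by (simp add: of_real_sum)
  finally have "(\<Sum>i\<in>A. Re (\<sigma> (f i)) * Re (\<sigma> (f i))) = 0"
    using assms(4) \<sigma>0 by (metis of_real_eq_0_iff)
  then have "Re (\<sigma> (f i)) * Re (\<sigma> (f i)) = 0"
    using assms(3,5) by (subst (asm) sum_nonneg_eq_0_iff) auto
  then have "\<sigma> (f i) = 0"
    by (metis re mult_eq_0_iff of_real_0)
  then have "\<sigma> (f i * inverse (f i)) = 0"
    by (simp add: hom(3))
  then show ?thesis
    using hom(1) by (metis right_inverse zero_neq_one)
qed

section \<open>Semisimple modules and isotypic components\<close>

lemma linear_map_on_subset: "linear_map_on s V s' f \<Longrightarrow> W \<subseteq> V \<Longrightarrow> linear_map_on s W s' f"
  unfolding linear_map_on_def by blast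

lemma (in vector_space) linear_map_on_sum:
  assumes "linear_map_on scale V s' f" "subspace V" "\<And>i. i \<in> A \<Longrightarrow> x i \<in> V"
  shows "f (\<Sum>i\<in>A. x i) = (\<Sum>i\<in>A. f (x i))"
proof -
  have "f 0 = 0"
    using assms(1) subspace_0[OF assms(2)] unfolding linear_map_on_def
    by (metis add_cancel_right_right)
  then show ?thesis
    using assms(3)
  proof (induction A rule: infinite_finite_induct)
    case (insert i A)
    then have "(\<Sum>i\<in>A. x i) \<in> V"
      by (intro subspace_sum assms(2)) auto
    then show ?case
      using insert assms(1) unfolding linear_map_on_def by simp
  qed auto
qed

lemma (in group_module) submoduleI:
  assumes "W \<subseteq> V" "subspace W" "\<And>g w. g \<in> carrier G \<Longrightarrow> w \<in> W \<Longrightarrow> \<rho> g w \<in> W"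
  shows "group_module G scale W \<rho>"
  by unfold_locales
    (use assms in \<open>auto intro: act_add act_scale act_one act_mult simp: subset_eq\<close>)

lemma (in group_module) act_inv_act:
  assumes "g \<in> carrier G" "v \<in> V"
  shows "\<rho> (inv g) (\<rho> g v) = v" "\<rho> g (\<rho> (inv g) v) = v"
  using assms act_mult[of "inv g" g v] act_mult[of g "inv g" v] act_one by auto

lemma (in group_module) act_0: "g \<in> carrier G \<Longrightarrow> \<rho> g 0 = 0"
  using act_scale[of g 0 0] subspace_0[OF subspace_V] by simp

lemma (in group_module) linear_act: "g \<in> carrier G \<Longrightarrow> linear_map_on scale V scale (\<rho> g)"
  unfolding linear_map_on_def using act_add act_scale by blast

text \<open>For fixed \<open>g\<close>, the vectors of \<open>V\<close> that \<open>g\<close> sends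
  into the span form a subspace, so invariance only has to be checked on generators.\<close>

lemma (in group_module) group_module_span:
  assumes "S \<subseteq> V" "\<And>g v. g \<in> carrier G \<Longrightarrow> v \<in> S \<Longrightarrow> \<rho> g v \<in> span S"
  shows "group_module G scale (span S) \<rho>"
proof (rule submoduleI)
  show SV: "span S \<subseteq> V"
    using assms(1) subspace_V by (rule span_minimal)
  fix g w assume g: "g \<in> carrier G" and w: "w \<in> span S"
  let ?T = "{v \<in> V. \<rho> g v \<in> span S}"
  have "span S \<subseteq> ?T"
  proof (rule span_minimal)
    show "S \<subseteq> ?T"
      using assms g by auto
    show "subspace ?T"
      using g subspace_V unfolding subspace_def
      by (auto simp: act_add act_scale act_0 span_zero span_add span_scale)
  qed
  then show "\<rho> g w \<in> span S"
    using w by blast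
qed (rule subspace_span)

section \<open>Homomorphisms, isomorphisms and Schur's lemma\<close>

definition equivariant_map ::
  "('g, 'x) monoid_scheme \<Rightarrow>
   ('k \<Rightarrow> 'v::ab_group_add \<Rightarrow> 'v) \<Rightarrow> 'v set \<Rightarrow> ('g \<Rightarrow> 'v \<Rightarrow> 'v) \<Rightarrow>
   ('k \<Rightarrow> 'w::ab_group_add \<Rightarrow> 'w) \<Rightarrow> 'w set \<Rightarrow> ('g \<Rightarrow> 'w \<Rightarrow> 'w) \<Rightarrow> ('v \<Rightarrow> 'w) \<Rightarrow> bool"
where
  "equivariant_map G s V \<rho> s' W \<tau> f \<longleftrightarrow>
     linear_map_on s V s' f \<and> (\<forall>v\<in>V. f v \<in> W) \<and> (\<forall>g\<in>carrier G. \<forall>v\<in>V. f (\<rho> g v) = \<tau> g (f v))"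

lemma module_isomorphic_iff:
  "module_isomorphic G s V \<rho> s' W \<tau> \<longleftrightarrow> (\<exists>f. equivariant_map G s V \<rho> s' W \<tau> f \<and> bij_betw f V W)"
  unfolding module_isomorphic_def equivariant_map_def by (auto dest: bij_betw_apply)

lemma equivariant_map_comp:
  assumes "equivariant_map G s V \<rho> s' W \<tau> f" "equivariant_map G s' W \<tau> s'' X \<omega> h"
  shows "equivariant_map G s V \<rho> s'' X \<omega> (h \<circ> f)"
  using assms unfolding equivariant_map_def linear_map_on_def by simp

lemma equivariant_map_subset:
  assumes "equivariant_map G s V \<rho> s' W \<tau> f" "V' \<subseteq> V"
  shows "equivariant_map G s V' \<rho> s' W \<tau> f"
  using assms unfolding equivariant_map_def linear_map_on_def by blast

lemma equivariant_map_inv: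
  assumes "group_module G s V \<rho>" "equivariant_map G s V \<rho> s' W \<tau> f" "bij_betw f V W"
  shows "equivariant_map G s' W \<tau> s V \<rho> (inv_into V f)"
proof -
  interpret group_module G s V \<rho> by fact
  have img: "W = f ` V" and inj: "inj_on f V"
    using assms(3) by (auto simp: bij_betw_def)
  have f: "\<And>v w. v \<in> V \<Longrightarrow> w \<in> V \<Longrightarrow> f v + f w = f (v + w)"
    "\<And>c v. v \<in> V \<Longrightarrow> s' c (f v) = f (s c v)"
    "\<And>g v. g \<in> carrier G \<Longrightarrow> v \<in> V \<Longrightarrow> \<tau> g (f v) = f (\<rho> g v)"
    using assms(2) unfolding equivariant_map_def linear_map_on_def by auto
  show ?thesis
    unfolding equivariant_map_def linear_map_on_def img using subspace_V
    by (auto simp: f inv_into_f_f[OF inj] act_closed subspace_add subspace_scale)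
qed

lemma module_isomorphic_sym:
  assumes "group_module G s V \<rho>" "module_isomorphic G s V \<rho> s' W \<tau>"
  shows "module_isomorphic G s' W \<tau> s V \<rho>"
proof -
  obtain f where "equivariant_map G s V \<rho> s' W \<tau> f" "bij_betw f V W"
    using assms(2) unfolding module_isomorphic_iff by blast
  then show ?thesis
    using equivariant_map_inv[OF assms(1)] bij_betw_inv_into unfolding module_isomorphic_iff by blast
qed

lemma module_isomorphic_trans:
  assumes "module_isomorphic G s V \<rho> s' W \<tau>" "module_isomorphic G s' W \<tau> s'' X \<omega>"
  shows "module_isomorphic G s V \<rho> s'' X \<omega>"
proof -
  obtain f where "equivariant_map G s V \<rho> s' W \<tau> f" "bij_betw f V W"
    using assms(1) unfolding module_isomorphic_iff by blast
  moreover obtain h where "equivariant_map G s' W \<tau> s'' X \<omega> h" "bij_betw h W X"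
    using assms(2) unfolding module_isomorphic_iff by blast
  ultimately show ?thesis
    using equivariant_map_comp bij_betw_trans unfolding module_isomorphic_iff by blast
qed

lemma module_isomorphic_cong_action:
  assumes "\<And>g v. g \<in> carrier G \<Longrightarrow> v \<in> V \<Longrightarrow> \<rho> g v = \<rho>' g v"
  shows "module_isomorphic G s V \<rho> s V \<rho>'"
  unfolding module_isomorphic_def linear_map_on_def
  using assms by (intro exI[of _ id]) auto

lemma irreducible_moduleD:
  assumes "irreducible_module G s V \<rho>" "W \<subseteq> V" "group_module G s W \<rho>" "w \<in> W" "w \<noteq> 0"
  shows "W = V"
proof -
  have "W = {0} \<or> W = V"
    using assms(1-3) unfolding irreducible_module_def by simp
  then show ?thesis
    using assms(4,5) by auto
qed

text \<open>Kernel and image are submodules. The vector \<open>v\<close> excludes the kernel from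
  being all of \<open>V\<close> and the image from being zero, so irreducibility on both sides
  leaves only a bijection.\<close>

lemma schur:
  assumes V: "irreducible_module G s V \<rho>" and W: "irreducible_module G s' W \<tau>"
    and f: "equivariant_map G s V \<rho> s' W \<tau> f" and v: "v \<in> V" "f v \<noteq> 0"
  shows "module_isomorphic G s V \<rho> s' W \<tau>"
proof -
  interpret V: group_module G s V \<rho> using V by (simp add: irreducible_module_def)
  interpret W: group_module G s' W \<tau> using W by (simp add: irreducible_module_def)
  have add: "\<And>v w. v \<in> V \<Longrightarrow> w \<in> V \<Longrightarrow> f (v + w) = f v + f w"
    and scale: "\<And>c v. v \<in> V \<Longrightarrow> f (s c v) = s' c (f v)"
    and act: "\<And>g v. g \<in> carrier G \<Longrightarrow> v \<in> V \<Longrightarrow> f (\<rho> g v) = \<tau> g (f v)"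
    and fW: "\<And>v. v \<in> V \<Longrightarrow> f v \<in> W"
    using f unfolding equivariant_map_def linear_map_on_def by auto
  have V0: "0 \<in> V"
    using V.subspace_0[OF V.subspace_V] .
  have f0: "f 0 = 0"
    using add[OF V0 V0] by simp
  let ?K = "{v \<in> V. f v = 0}"
  have "group_module G s ?K \<rho>"
    using V.subspace_V unfolding V.subspace_def
    by (intro V.submoduleI)
      (auto simp: V.subspace_def f0 add scale act V.act_closed W.act_0)
  then have K: "x = 0" if "x \<in> V" "f x = 0" for x
    using irreducible_moduleD[OF V, of ?K x] v that by blast
  have "group_module G s' (f ` V) \<tau>"
  proof (rule W.submoduleI)
    show "W.subspace (f ` V)"
      unfolding W.subspace_def
    proof (intro conjI ballI allI)
      show "0 \<in> f ` V"
        using f0 V0 by force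
      show "x + y \<in> f ` V" if "x \<in> f ` V" "y \<in> f ` V" for x y
        using that V.subspace_add[OF V.subspace_V] by (auto simp flip: add)
      show "s' c x \<in> f ` V" if "x \<in> f ` V" for c x
        using that V.subspace_scale[OF V.subspace_V] by (auto simp flip: scale)
    qed
    show "\<tau> g w \<in> f ` V" if "g \<in> carrier G" "w \<in> f ` V" for g w
      using that V.act_closed by (auto simp flip: act)
  qed (use fW in auto)
  then have img: "f ` V = W"
    using irreducible_moduleD[OF W, of "f ` V" "f v"] v fW by blast
  have "inj_on f V"
  proof (rule inj_onI)
    fix x y assume xy: "x \<in> V" "y \<in> V" "f x = f y"
    have "x - y \<in> V"
      using xy V.subspace_diff[OF V.subspace_V] by blast
    moreover have "f (x - y) = 0"
      using add[OF \<open>x - y \<in> V\<close> \<open>y \<in> V\<close>] xy by simp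
    ultimately show "x = y"
      using K[of "x - y"] by simp
  qed
  then show ?thesis
    using f img unfolding module_isomorphic_iff bij_betw_def by blast
qed

section \<open>Direct sums and their projections\<close>

lemma (in vector_space) internal_direct_sum_subset:
  assumes "internal_direct_sum scale V J W" "j \<in> J"
  shows "W j \<subseteq> V"
proof
  fix w assume w: "w \<in> W j"
  have fin: "finite J" and sub: "\<And>i. i \<in> J \<Longrightarrow> subspace (W i)"
    and V: "V = {\<Sum>i\<in>J. x i | x. \<forall>i\<in>J. x i \<in> W i}"
    using assms(1) unfolding internal_direct_sum_def by auto
  have "w = (\<Sum>i\<in>J. if i = j then w else 0)"
    using fin assms(2) by simp
  then show "w \<in> V"
    unfolding V using w sub subspace_0 by fastforce
qed

lemma (in group_module) direct_sum_projections:
  assumes ds: "internal_direct_sum scale V J W" and W: "\<And>j. j \<in> J \<Longrightarrow> group_module G scale (W j) \<rho>"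
  obtains \<pi> where "\<And>j. j \<in> J \<Longrightarrow> equivariant_map G scale V \<rho> scale (W j) \<rho> (\<pi> j)"
    and "\<And>v. v \<in> V \<Longrightarrow> (\<Sum>j\<in>J. \<pi> j v) = v"
    and "\<And>x i. (\<And>j. j \<in> J \<Longrightarrow> x j \<in> W j) \<Longrightarrow> i \<in> J \<Longrightarrow> \<pi> i (\<Sum>j\<in>J. x j) = x i"
proof -
  have sub: "\<And>j. j \<in> J \<Longrightarrow> subspace (W j)"
    and V: "V = {\<Sum>i\<in>J. x i | x. \<forall>i\<in>J. x i \<in> W i}"
    and indep: "\<And>x. (\<forall>i\<in>J. x i \<in> W i) \<Longrightarrow> (\<Sum>i\<in>J. x i) = 0 \<Longrightarrow> \<forall>i\<in>J. x i = 0"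
    using ds unfolding internal_direct_sum_def by auto
  have "\<forall>v\<in>V. \<exists>x. (\<forall>j\<in>J. x j \<in> W j) \<and> (\<Sum>j\<in>J. x j) = v"
    using V by auto
  then obtain p where p: "\<And>v j. v \<in> V \<Longrightarrow> j \<in> J \<Longrightarrow> p v j \<in> W j" "\<And>v. v \<in> V \<Longrightarrow> (\<Sum>j\<in>J. p v j) = v"
    by metis
  \<comment> \<open>Uniqueness of the components gives linearity and equivariance at once: sums,
    multiples and translates of the components of vectors again lie in the summands and have the
    right total.\<close>
  have uniq: "p v i = x i" if x: "\<And>j. j \<in> J \<Longrightarrow> x j \<in> W j" and v: "v = (\<Sum>j\<in>J. x j)" and i: "i \<in> J"
    for x v i
  proof -
    have vV: "v \<in> V"
      using x v V by auto
    have "\<forall>j\<in>J. p v j - x j = 0"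
    proof (rule indep)
      show "\<forall>j\<in>J. p v j - x j \<in> W j"
        using p(1)[OF vV] x sub subspace_diff by blast
      show "(\<Sum>j\<in>J. p v j - x j) = 0"
        using p(2)[OF vV] v by (simp add: sum_subtractf)
    qed
    then show ?thesis
      using i by simp
  qed
  show ?thesis
  proof (rule that[of "\<lambda>j v. p v j"])
    show "equivariant_map G scale V \<rho> scale (W j) \<rho> (\<lambda>v. p v j)" if j: "j \<in> J" for j
      unfolding equivariant_map_def linear_map_on_def
    proof (intro conjI ballI allI)
      fix v w assume vw: "v \<in> V" "w \<in> V"
      show "p (v + w) j = p v j + p w j"
        by (rule uniq) (use vw p sub j in \<open>auto simp: sum.distrib subspace_add\<close>)
    next
      fix c v assume v: "v \<in> V"
      show "p (scale c v) j = scale c (p v j)"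
        by (rule uniq) (use v p sub j in \<open>auto simp: subspace_scale simp flip: scale_sum_right\<close>)
    next
      fix g v assume g: "g \<in> carrier G" and v: "v \<in> V"
      show "p (\<rho> g v) j = \<rho> g (p v j)"
      proof (rule uniq)
        show "\<rho> g (p v j) \<in> W j" if "j \<in> J" for j
          using group_module.act_closed[OF W[OF that]] p(1)[OF v that] g by blast
        have "\<rho> g (\<Sum>j\<in>J. p v j) = (\<Sum>j\<in>J. \<rho> g (p v j))"
          using p(1)[OF v] internal_direct_sum_subset[OF ds] by (intro linear_map_on_sum[OF linear_act[OF g] subspace_V]) auto
        then show "\<rho> g v = (\<Sum>j\<in>J. \<rho> g (p v j))"
          using p(2)[OF v] by simp
      qed (fact j)
    qed (use p j in auto)
  qed (use p uniq in auto)
qed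

section \<open>Isotypic components of semisimple modules\<close>

lemma isotypic_component_subset:
  assumes "group_module G s V \<rho>"
  shows "isotypic_component G s V \<rho> s' U \<tau> \<subseteq> V"
proof -
  interpret group_module G s V \<rho> by fact
  show ?thesis
    unfolding isotypic_component_def by (rule span_minimal) (auto simp: subspace_V)
qed

lemma group_module_isotypic_component:
  assumes "group_module G s V \<rho>"
  shows "group_module G s (isotypic_component G s V \<rho> s' U \<tau>) \<rho>"
proof -
  interpret group_module G s V \<rho> by fact
  show ?thesis
    unfolding isotypic_component_def
    by (rule group_module_span) (auto intro!: span_base dest: group_module.act_closed)
qed

lemma isotypic_component_cong:
  assumes "group_module G s' U \<tau>" "module_isomorphic G s' U \<tau> s'' U' \<tau>'"
  shows "isotypic_component G s V \<rho> s' U \<tau> = isotypic_component G s V \<rho> s'' U' \<tau>'"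
proof -
  have "module_isomorphic G s W \<rho> s' U \<tau> \<longleftrightarrow> module_isomorphic G s W \<rho> s'' U' \<tau>'" for W
    using assms module_isomorphic_trans module_isomorphic_sym by meson
  then show ?thesis
    unfolding isotypic_component_def by simp
qed

text \<open>The projections are part of the data, so that membership in an isotypic component can be
  tested on the coordinates \<open>\<pi> j v\<close>.\<close>

locale semisimple_module = group_module +
  fixes J :: "'i set" and W :: "'i \<Rightarrow> _ set" and \<pi> :: "'i \<Rightarrow> _ \<Rightarrow> _"
  assumes finite_J: "finite J"
    and irreducible_W: "j \<in> J \<Longrightarrow> irreducible_module G scale (W j) \<rho>"
    and equivariant_\<pi>: "j \<in> J \<Longrightarrow> equivariant_map G scale V \<rho> scale (W j) \<rho> (\<pi> j)"
    and sum_\<pi>: "v \<in> V \<Longrightarrow> (\<Sum>j\<in>J. \<pi> j v) = v"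
    and W_subset: "j \<in> J \<Longrightarrow> W j \<subseteq> V"
    and \<pi>_sum: "(\<And>j. j \<in> J \<Longrightarrow> x j \<in> W j) \<Longrightarrow> i \<in> J \<Longrightarrow> \<pi> i (\<Sum>j\<in>J. x j) = x i"

lemma (in group_module) semisimple_moduleI:
  assumes "internal_direct_sum scale V J W" and "\<And>j. j \<in> J \<Longrightarrow> irreducible_module G scale (W j) \<rho>"
  obtains \<pi> where "semisimple_module G scale V \<rho> J W \<pi>"
proof -
  have W: "group_module G scale (W j) \<rho>" if "j \<in> J" for j
    using assms that by (simp add: irreducible_module_def)
  obtain \<pi> where \<pi>: "\<And>j. j \<in> J \<Longrightarrow> equivariant_map G scale V \<rho> scale (W j) \<rho> (\<pi> j)"
    "\<And>v. v \<in> V \<Longrightarrow> (\<Sum>j\<in>J. \<pi> j v) = v"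
    "\<And>x i. (\<And>j. j \<in> J \<Longrightarrow> x j \<in> W j) \<Longrightarrow> i \<in> J \<Longrightarrow> \<pi> i (\<Sum>j\<in>J. x j) = x i"
    using direct_sum_projections[OF assms(1) W] by metis
  have "finite J"
    using assms(1) unfolding internal_direct_sum_def by auto
  then have "semisimple_module G scale V \<rho> J W \<pi>"
    using \<pi> assms(2) internal_direct_sum_subset[OF assms(1)] by unfold_locales auto
  then show ?thesis
    by (rule that)
qed

context semisimple_module
begin

lemma subspace_W: "j \<in> J \<Longrightarrow> subspace (W j)"
  using group_module.subspace_V[of G scale "W j" \<rho>] irreducible_W[of j]
  by (simp add: irreducible_module_def)

lemma linear_\<pi>: "j \<in> J \<Longrightarrow> linear_map_on scale V scale (\<pi> j)"
  and \<pi>_in_W: "j \<in> J \<Longrightarrow> v \<in> V \<Longrightarrow> \<pi> j v \<in> W j"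
  using equivariant_\<pi> unfolding equivariant_map_def by auto

lemma \<pi>_0: "j \<in> J \<Longrightarrow> \<pi> j 0 = 0"
  using linear_map_on_sum[OF linear_\<pi> subspace_V, of j "{}"] by simp

lemma \<pi>_of_W:
  assumes "i \<in> J" "j \<in> J" "w \<in> W j"
  shows "\<pi> i w = (if i = j then w else 0)"
proof -
  have "\<pi> i (\<Sum>k\<in>J. if k = j then w else 0) = (if i = j then w else 0)"
    using assms subspace_W subspace_0 by (intro \<pi>_sum) auto
  then show ?thesis
    using assms finite_J by simp
qed

text \<open>By Schur's lemma a submodule isomorphic to \<open>U\<close> projects to zero on every
  summand of another type. Conversely a vector is the sum of its projections, and those on summands
  isomorphic to \<open>U\<close> lie in generating submodules. So the component is the sum of the
  summands \<open>W j\<close> of the type of \<open>U\<close>.\<close>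

lemma isotypic_component_eq:
  assumes U: "irreducible_module G s' U \<tau>"
  shows "isotypic_component G scale V \<rho> s' U \<tau> =
    {v \<in> V. \<forall>j\<in>J. \<not> module_isomorphic G scale (W j) \<rho> s' U \<tau> \<longrightarrow> \<pi> j v = 0}"
    (is "?C = ?R")
proof
  have gmU: "group_module G s' U \<tau>"
    using U by (simp add: irreducible_module_def)
  have sub: "subspace ?R"
    using subspace_V linear_\<pi> unfolding subspace_def linear_map_on_def by (auto simp: \<pi>_0)
  show "?C \<subseteq> ?R"
    unfolding isotypic_component_def
  proof (rule span_minimal[OF _ sub], safe)
    fix X x j
    assume X: "X \<subseteq> V" "group_module G scale X \<rho>" "module_isomorphic G scale X \<rho> s' U \<tau>"
      and x: "x \<in> X" and j: "j \<in> J" and niso: "\<not> module_isomorphic G scale (W j) \<rho> s' U \<tau>"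
    obtain f where f: "equivariant_map G s' U \<tau> scale X \<rho> f" "bij_betw f U X"
      using module_isomorphic_sym[OF X(2,3)] unfolding module_isomorphic_iff by blast
    obtain u where u: "u \<in> U" "f u = x"
      using f(2) x by (auto simp: bij_betw_def)
    have map: "equivariant_map G s' U \<tau> scale (W j) \<rho> (\<pi> j \<circ> f)"
      using equivariant_map_comp[OF f(1) equivariant_map_subset[OF equivariant_\<pi>[OF j] X(1)]] .
    show "\<pi> j x = 0"
    proof (rule ccontr)
      assume "\<pi> j x \<noteq> 0"
      then have "module_isomorphic G s' U \<tau> scale (W j) \<rho>"
        using schur[OF U irreducible_W[OF j] map u(1)] u(2) by simp
      then show False
        using niso module_isomorphic_sym[OF gmU] by blast
    qed
  qed (use subset_eq in auto)
  show "?R \<subseteq> ?C"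
  proof
    fix v assume v: "v \<in> ?R"
    have "(\<Sum>j\<in>J. \<pi> j v) \<in> ?C"
      unfolding isotypic_component_def
    proof (rule span_sum)
      fix j assume j: "j \<in> J"
      show "\<pi> j v \<in> span (\<Union> {W. W \<subseteq> V \<and> group_module G scale W \<rho> \<and>
          module_isomorphic G scale W \<rho> s' U \<tau>})"
      proof (cases "module_isomorphic G scale (W j) \<rho> s' U \<tau>")
        case True
        then show ?thesis
          using \<pi>_in_W[OF j] v W_subset[OF j] irreducible_W[OF j]
          unfolding irreducible_module_def by (intro span_base) blast
      next
        case False
        then show ?thesis
          using v j by (simp add: span_zero)
      qed
    qed
    then show "v \<in> ?C"
      using v sum_\<pi> by simp
  qed
qed

lemma isotypic_component_isomorphic_power:
  assumes U: "irreducible_module G s' U \<tau>"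
    and e: "e = card {j \<in> J. module_isomorphic G scale (W j) \<rho> s' U \<tau>}"
  shows "module_isomorphic G scale (isotypic_component G scale V \<rho> s' U \<tau>) \<rho>
    (power_scale s') (power_space e U) (power_action e \<tau>)"
proof -
  define A where "A = {j \<in> J. module_isomorphic G scale (W j) \<rho> s' U \<tau>}"
  define C where "C = isotypic_component G scale V \<rho> s' U \<tau>"
  have C: "C = {v \<in> V. \<forall>j\<in>J - A. \<pi> j v = 0}"
    unfolding C_def A_def isotypic_component_eq[OF U] by auto
  have AJ: "A \<subseteq> J" and finA: "finite A"
    using finite_J by (auto simp: A_def)
  obtain n where n: "bij_betw n {..<e} A"
    using ex_bij_betw_nat_finite[OF finA] e unfolding A_def lessThan_atLeast0 by blast
  have nA: "n k \<in> A" "n k \<in> J" if "k < e" for k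
    using n AJ that by (auto dest: bij_betw_apply)
  have "\<forall>j\<in>A. \<exists>f. equivariant_map G scale (W j) \<rho> s' U \<tau> f \<and> bij_betw f (W j) U"
    unfolding A_def module_isomorphic_iff by auto
  then obtain \<phi> where \<phi>: "\<And>j. j \<in> A \<Longrightarrow> equivariant_map G scale (W j) \<rho> s' U \<tau> (\<phi> j)"
    "\<And>j. j \<in> A \<Longrightarrow> bij_betw (\<phi> j) (W j) U"
    by metis
  have \<phi>\<pi>: "equivariant_map G scale V \<rho> s' U \<tau> (\<phi> (n k) \<circ> \<pi> (n k))" if "k < e" for k
    using equivariant_map_comp[OF equivariant_\<pi> \<phi>(1)] nA[OF that] by blast
  \<comment> \<open>The enumeration \<open>n\<close> turns the summands isomorphic to
    \<open>U\<close> into positions of a tuple, and \<open>\<phi>\<close> moves each coordinate into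
    \<open>U\<close>. The value 0 from \<open>e\<close> on is what \<open>power_space\<close>
    requires.\<close>
  define f where "f v = (\<lambda>k. if k < e then \<phi> (n k) (\<pi> (n k) v) else 0)" for v
  interpret U: group_module G s' U \<tau>
    using U by (simp add: irreducible_module_def)
  have CV: "C \<subseteq> V"
    by (auto simp: C)
  have "equivariant_map G scale V \<rho> (power_scale s') (power_space e U) (power_action e \<tau>) f"
    using \<phi>\<pi> unfolding equivariant_map_def linear_map_on_def f_def
      power_scale_def power_action_def power_space_def
    by (auto simp: fun_eq_iff)
  then have eq: "equivariant_map G scale C \<rho> (power_scale s') (power_space e U) (power_action e \<tau>) f"
    using CV by (rule equivariant_map_subset)
  have "bij_betw f C (power_space e U)"
    unfolding bij_betw_def
  proof (intro conjI subset_antisym)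
    show "inj_on f C"
    proof (rule inj_onI)
      fix v w assume vw: "v \<in> C" "w \<in> C" "f v = f w"
      have "\<pi> j v = \<pi> j w" if j: "j \<in> J" for j
      proof (cases "j \<in> A")
        case True
        then obtain k where k: "k < e" "j = n k"
          using n by (auto simp: bij_betw_def)
        then have "\<phi> j (\<pi> j v) = \<phi> j (\<pi> j w)"
          using fun_cong[OF vw(3), of k] by (simp add: f_def)
        then show ?thesis
          using \<phi>(2)[OF True] \<pi>_in_W[OF j] vw CV unfolding bij_betw_def inj_on_def by blast
      next
        case False
        then show ?thesis
          using vw j by (simp add: C)
      qed
      then have "(\<Sum>j\<in>J. \<pi> j v) = (\<Sum>j\<in>J. \<pi> j w)"
        by (rule sum.cong[OF refl])
      then show "v = w"
        using vw CV by (simp add: sum_\<pi> subset_eq)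
    qed
    show "f ` C \<subseteq> power_space e U"
      using eq unfolding equivariant_map_def by blast
    show "power_space e U \<subseteq> f ` C"
    proof
      fix y assume y: "y \<in> power_space e U"
      \<comment> \<open>The preimage is assembled from its coordinates by undoing \<open>n\<close>
        and \<open>\<phi>\<close>. Zero coordinates outside \<open>A\<close> keep the resulting sum
        inside the component.\<close>
      define x where
        "x j = (if j \<in> A then inv_into (W j) (\<phi> j) (y (inv_into {..<e} n j)) else 0)" for j
      have xA: "x (n k) \<in> W (n k)" "\<phi> (n k) (x (n k)) = y k" if "k < e" for k
      proof -
        have "inv_into {..<e} n (n k) = k"
          using n that by (simp add: bij_betw_inv_into_left)
        moreover have "y k \<in> \<phi> (n k) ` W (n k)"
          using y that \<phi>(2)[OF nA(1)[OF that]] by (simp add: power_space_def bij_betw_def)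
        ultimately show "x (n k) \<in> W (n k)" "\<phi> (n k) (x (n k)) = y k"
          using nA(1)[OF that] by (auto simp: x_def inv_into_into f_inv_into_f)
      qed
      have xW: "x j \<in> W j" if "j \<in> J" for j
      proof (cases "j \<in> A")
        case True
        then show ?thesis
          using n xA(1) by (auto simp: bij_betw_def)
      next
        case False
        then show ?thesis
          using subspace_0[OF subspace_W[OF that]] by (simp add: x_def)
      qed
      define v where "v = (\<Sum>j\<in>J. x j)"
      have \<pi>v: "\<pi> j v = x j" if "j \<in> J" for j
        unfolding v_def using xW that by (rule \<pi>_sum)
      have "v \<in> V"
        unfolding v_def using xW W_subset by (intro subspace_sum subspace_V) auto
      then have "v \<in> C"
        by (auto simp: C \<pi>v) (simp add: x_def)
      moreover have "f v = y"
        using y xA nA by (auto simp: f_def \<pi>v power_space_def fun_eq_iff)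
      ultimately show "y \<in> f ` C"
        by blast
    qed
  qed
  then show ?thesis
    using eq unfolding module_isomorphic_iff C_def by blast
qed

end

section \<open>Definite forms and orthogonality\<close>

text \<open>Riesz representation over a field without order or completeness: Gram-Schmidt, one
  generator at a time. Definiteness makes \<open>B z z\<close> nonzero for every nonzero
  \<open>z\<close>, so no division fails.\<close>

lemma (in vector_space) definite_form_represents:
  assumes sub: "subspace V" and B: "symmetric_bilinear_form scale V B"
    and definite: "\<And>v. v \<in> V \<Longrightarrow> B v v = 0 \<Longrightarrow> v = 0"
    and S: "finite S" "S \<subseteq> V" and l: "linear_map_on scale V (*) l"
  shows "\<exists>b\<in>span S. \<forall>y\<in>span S. l y = B b y"
  using S l
proof (induction S arbitrary: l)
  case empty
  then show ?case
    using B subspace_0[OF sub] linear_map_on_sum[OF empty(2) sub, of "{}"]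
      linear_map_on_sum[of V "(*)" "B 0" "{}"] sub
    unfolding symmetric_bilinear_form_def by auto
next
  case (insert x S)
  have x: "x \<in> V" and SV: "span S \<subseteq> V"
    using insert.prems span_minimal[OF _ sub] by auto
  have Bl: "B (v + w) u = B v u + B w u" "B (scale c v) u = c * B v u" "B u v = B v u"
    "B u (v + w) = B u v + B u w" "B u (scale c v) = c * B u v"
    if "v \<in> V" "w \<in> V" "u \<in> V" for v w u c
    using B that unfolding symmetric_bilinear_form_def linear_map_on_def by auto
  have ll: "l (v + w) = l v + l w" "l (scale c v) = c * l v" if "v \<in> V" "w \<in> V" for v w c
    using insert.prems(2) that unfolding linear_map_on_def by auto
  obtain b where b: "b \<in> span S" "\<forall>y\<in>span S. l y = B b y"
    using insert.IH[OF _ insert.prems(2)] insert.prems(1) by auto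
  have "linear_map_on scale V (*) (B x)"
    using B x unfolding symmetric_bilinear_form_def by auto
  then obtain a where a: "a \<in> span S" "\<forall>y\<in>span S. B x y = B a y"
    using insert.IH[of "B x"] insert.prems(1) by auto
  \<comment> \<open>Here \<open>a\<close> represents the functional \<open>B x\<close> on the span
    of \<open>S\<close>, so it is the orthogonal projection of \<open>x\<close>, and
    \<open>z\<close> is orthogonal to that span.\<close>
  define z where "z = x - a"
  have xz: "x = a + z"
    by (simp add: z_def)
  have aV: "a \<in> V" and bV: "b \<in> V"
    using a b SV by auto
  have zV: "z \<in> V"
    unfolding z_def using x aV subspace_diff[OF sub] by blast
  have orth: "B z y = 0" if "y \<in> span S" for y
  proof -
    have "B a y + B z y = B a y"
      using Bl(1)[OF aV zV] a(2) that SV xz by (metis subsetD)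
    then show ?thesis by simp
  qed
  have decomp: "\<exists>k y'. y' \<in> span S \<and> y = y' + scale k z" if y: "y \<in> span (insert x S)" for y
  proof -
    obtain k where k: "y - scale k x \<in> span S"
      using y unfolding span_insert by blast
    have "y = (y - scale k x + scale k a) + scale k z"
      by (simp add: xz scale_right_distrib)
    moreover have "y - scale k x + scale k a \<in> span S"
      using k a(1) by (intro span_add span_scale)
    ultimately show ?thesis by blast
  qed
  have zS: "z \<in> span (insert x S)"
    unfolding z_def using a(1) span_mono[of S "insert x S"]
    by (intro span_diff) (auto intro: span_base)
  show ?case
  proof (cases "z = 0")
    case True
    then show ?thesis
      using decomp b span_mono[of S "insert x S"] by fastforce
  next
    case False
    then have nz: "B z z \<noteq> 0"
      using definite zV by blast
    \<comment> \<open>The coefficient is chosen so that \<open>scale d z\<close> represents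
      \<open>l\<close> at \<open>z\<close>; by orthogonality it does not disturb the values of
      \<open>b\<close> on the span of \<open>S\<close>.\<close>
    define d where "d = l z / B z z"
    have dz: "d * B z z = l z"
      using nz by (simp add: d_def)
    have "l y = B (b + scale d z) y" if y: "y \<in> span (insert x S)" for y
    proof -
      obtain k y' where y': "y' \<in> span S" "y = y' + scale k z"
        using decomp[OF y] by blast
      have V: "y' \<in> V" "scale k z \<in> V" "scale d z \<in> V"
        using y' SV subspace_scale[OF sub zV] by auto
      have "y \<in> V"
        using y' V subspace_add[OF sub] by blast
      have "B (b + scale d z) y = B b y + d * B z y"
        using Bl(1)[OF bV V(3) \<open>y \<in> V\<close>] Bl(2)[OF zV zV \<open>y \<in> V\<close>] by simp
      also have "B b y = B b y' + k * B b z"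
        unfolding y' using Bl(4)[OF V(1,2) bV] Bl(5)[OF zV zV bV] by simp
      also have "B b z = 0"
        using orth[OF b(1)] Bl(3)[OF zV zV bV] by simp
      also have "B z y = k * B z z"
        unfolding y' using Bl(4)[OF V(1,2) zV] Bl(5)[OF zV zV zV] orth[OF y'(1)] by simp
      also have "B b y' = l y'"
        using b y' by simp
      finally have "B (b + scale d z) y = l y' + k * l z"
        using dz by (simp add: mult.left_commute)
      also have "\<dots> = l y"
        unfolding y' using ll V(1,2) zV by simp
      finally show ?thesis ..
    qed
    moreover have "b + scale d z \<in> span (insert x S)"
      using b(1) zS span_mono[of S "insert x S"] by (intro span_add span_scale) auto
    ultimately show ?thesis
      by blast
  qed
qed

text \<open>The orbit of a nonzero vector is finite and spans a nonzero submodule. This is the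
  source of finite dimensionality, needed for the definite form.\<close>

lemma irreducible_module_finite_span:
  assumes V: "irreducible_module G s V \<rho>" and fin: "finite (carrier G)"
  obtains S where "finite S" "S \<subseteq> V" "module.span s S = V"
proof -
  interpret group_module G s V \<rho>
    using V by (simp add: irreducible_module_def)
  obtain v where v: "v \<in> V" "v \<noteq> 0"
    using V subspace_0[OF subspace_V] unfolding irreducible_module_def by blast
  let ?S = "(\<lambda>g. \<rho> g v) ` carrier G"
  have S: "?S \<subseteq> V"
    using v act_closed by auto
  have "group_module G s (span ?S) \<rho>"
    by (rule group_module_span[OF S]) (use v in \<open>auto intro!: span_base simp flip: act_mult\<close>)
  moreover have "v \<in> span ?S"
    using act_one[OF v(1)] by (intro span_base image_eqI[of _ _ "\<one>\<^bsub>G\<^esub>"]) auto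
  moreover have "span ?S \<subseteq> V"
    using S subspace_V by (rule span_minimal)
  ultimately have "span ?S = V"
    using irreducible_moduleD[OF V] v(2) by blast
  then show ?thesis
    using that[of ?S] fin S by blast
qed

text \<open>The form is the \<open>G\<close>-average of the standard form \<open>\<Sum>b. v\<^sub>b * w\<^sub>b\<close> of a basis; it is definite
  because sums of squares in a totally real field vanish only trivially.\<close>

lemma invariant_definite_form:
  fixes s :: "'k::field_char_0 \<Rightarrow> 'v::ab_group_add \<Rightarrow> 'v"
  assumes K: "number_field TYPE('k)" "totally_real TYPE('k)"
    and V: "group_module G s V \<rho>" and fin: "finite (carrier G)"
    and S: "finite S" "module.span s S = V"
  obtains B where "symmetric_bilinear_form s V B" "invariant_form G V \<rho> B"
    "\<And>v. v \<in> V \<Longrightarrow> B v v = 0 \<Longrightarrow> v = 0"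
proof -
  interpret group_module G s V \<rho> by fact
  obtain E where E: "E \<subseteq> V" "independent E" "V \<subseteq> span E"
    using maximal_independent_subset[of V] by blast
  have finE: "finite E"
    using independent_span_bound[OF S(1) E(2)] E(1) S(2) by blast
  define co where "co = representation E"
  have co_add: "co (v + w) b = co v b + co w b" if "v \<in> V" "w \<in> V" for v w b
    unfolding co_def using representation_add[OF E(2)] E(3) that by (simp add: subset_eq)
  have co_scale: "co (s c v) b = c * co v b" if "v \<in> V" for c v b
    unfolding co_def using representation_scale[OF E(2)] E(3) that by (simp add: subset_eq)
  have co_0: "v = 0" if v: "v \<in> V" and z: "\<And>b. b \<in> E \<Longrightarrow> co v b = 0" for v
  proof -
    have "(\<Sum>b\<in>E. s (co v b) b) = v"
      unfolding co_def using E finE v by (intro sum_representation_eq) auto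
    then show ?thesis
      using z by simp
  qed
  define B where "B v w = (\<Sum>g\<in>carrier G. \<Sum>b\<in>E. co (\<rho> g v) b * co (\<rho> g w) b)" for v w
  show ?thesis
  proof (rule that[of B])
    have sym: "B v w = B w v" for v w
      unfolding B_def by (simp add: mult.commute)
    have "linear_map_on s V (*) (\<lambda>v. B v w)" if "w \<in> V" for w
      unfolding linear_map_on_def B_def
      by (auto simp: act_add act_scale act_closed co_add co_scale distrib_right sum.distrib
          sum_distrib_left mult.assoc)
    then show "symmetric_bilinear_form s V B"
      unfolding symmetric_bilinear_form_def using sym by simp
    show "invariant_form G V \<rho> B"
      unfolding invariant_form_def
    proof (intro ballI)
      fix h v w assume h: "h \<in> carrier G" and vw: "v \<in> V" "w \<in> V"
      have "B (\<rho> h v) (\<rho> h w)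
          = (\<Sum>g\<in>carrier G. \<Sum>b\<in>E. co (\<rho> (g \<otimes>\<^bsub>G\<^esub> h) v) b * co (\<rho> (g \<otimes>\<^bsub>G\<^esub> h) w) b)"
        unfolding B_def using h vw by (intro sum.cong) (auto simp: act_mult)
      \<comment> \<open>Right multiplication by \<open>h\<close> permutes the group.\<close>
      also have "\<dots> = B v w"
        unfolding B_def
        by (rule sum.reindex_bij_witness[of _ "\<lambda>g. g \<otimes>\<^bsub>G\<^esub> inv\<^bsub>G\<^esub> h" "\<lambda>g. g \<otimes>\<^bsub>G\<^esub> h"])
          (use h in \<open>auto simp: m_assoc\<close>)
      finally show "B (\<rho> h v) (\<rho> h w) = B v w" .
    qed
    fix v assume v: "v \<in> V" and Bv: "B v v = 0"
    have sq: "(\<Sum>p\<in>carrier G \<times> E. co (\<rho> (fst p) v) (snd p) * co (\<rho> (fst p) v) (snd p)) = 0"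
      using Bv unfolding B_def by (simp add: sum.cartesian_product case_prod_unfold)
    have "co v b = 0" if "b \<in> E" for b
    proof -
      \<comment> \<open>The vanishing sum of squares runs over group elements and basis vectors; the
        terms at the identity are the squared coordinates of \<open>v\<close> itself.\<close>
      have "(\<one>\<^bsub>G\<^esub>, b) \<in> carrier G \<times> E"
        using that by simp
      then have "co (\<rho> (fst (\<one>\<^bsub>G\<^esub>, b)) v) (snd (\<one>\<^bsub>G\<^esub>, b)) = 0"
        using fin finE by (intro totally_real_sum_squares_eq_0[OF K _ sq]) auto
      then show ?thesis
        using act_one[OF v] by simp
    qed
    then show "v = 0"
      using co_0[OF v] by blast
  qed
qed

text \<open>The form \<open>F\<close> may be degenerate on \<open>X\<close>, but the definite
  \<open>B\<close> is not, so \<open>B\<close> identifies \<open>X\<close> with its dual. Through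
  this identification \<open>F\<close> becomes an equivariant map from \<open>W\<close> to
  \<open>X\<close>, which Schur's lemma forces to be zero.\<close>

lemma irreducible_submodules_orthogonal:
  assumes V: "group_module G s V \<rho>"
    and W: "irreducible_module G s W \<rho>" "W \<subseteq> V" and X: "irreducible_module G s X \<rho>" "X \<subseteq> V"
    and niso: "\<not> module_isomorphic G s W \<rho> s X \<rho>"
    and S: "finite S" "module.span s S = V"
    and B: "symmetric_bilinear_form s V B" "invariant_form G V \<rho> B"
      "\<And>v. v \<in> V \<Longrightarrow> B v v = 0 \<Longrightarrow> v = 0"
    and F: "symmetric_bilinear_form s V F" "invariant_form G V \<rho> F"
    and wx: "w \<in> W" "x \<in> X"
  shows "F w x = 0"
proof -
  interpret V: group_module G s V \<rho> by fact
  interpret W: group_module G s W \<rho> using W by (simp add: irreducible_module_def)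
  interpret X: group_module G s X \<rho> using X by (simp add: irreducible_module_def)
  have Bl: "B (v + w) u = B v u + B w u" "B (s c v) u = c * B v u"
    if "v \<in> V" "w \<in> V" "u \<in> V" for v w u c
    using B that unfolding symmetric_bilinear_form_def linear_map_on_def by auto
  have Fl: "F (v + w) u = F v u + F w u" "F (s c v) u = c * F v u"
    if "v \<in> V" "w \<in> V" "u \<in> V" for v w u c
    using F that unfolding symmetric_bilinear_form_def linear_map_on_def by auto
  obtain S' where S': "S' \<subseteq> X" "V.independent S'" "X \<subseteq> V.span S'"
    using V.maximal_independent_subset[of X] by blast
  have finS': "finite S'"
    using V.independent_span_bound[OF S(1) S'(2)] S'(1) X(2) S(2) by blast
  have span: "V.span S' = X"
    using S' V.span_minimal[OF S'(1) X.subspace_V] by blast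
  have "\<exists>b\<in>X. \<forall>y\<in>X. F v y = B b y" if "v \<in> V" for v
    using V.definite_form_represents[OF V.subspace_V B(1,3) finS', of "F v"] F(1) that S'(1) X(2)
    unfolding span symmetric_bilinear_form_def by blast
  then obtain T where T: "\<And>v. v \<in> V \<Longrightarrow> T v \<in> X" "\<And>v y. v \<in> V \<Longrightarrow> y \<in> X \<Longrightarrow> F v y = B (T v) y"
    by metis
  \<comment> \<open>Two vectors of \<open>X\<close> representing the same functional differ by a
    vector that is \<open>B\<close>-orthogonal to itself. Linearity and equivariance of
    \<open>T\<close> are all read off from this.\<close>
  have uniq: "T v = b" if v: "v \<in> V" and b: "b \<in> X" and eq: "\<And>y. y \<in> X \<Longrightarrow> F v y = B b y" for v b
  proof -
    let ?d = "T v - b"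
    have d: "?d \<in> X" "T v \<in> V" "b \<in> V" "?d \<in> V"
      using T(1)[OF v] b X(2) X.subspace_V V.subspace_diff by blast+
    have "B (?d + b) ?d = B ?d ?d + B b ?d"
      using d by (intro Bl(1))
    then have "B ?d ?d = 0"
      using eq[OF d(1)] T(2)[OF v d(1)] by simp
    then show ?thesis
      using B(3)[OF d(4)] by simp
  qed
  have "equivariant_map G s W \<rho> s X \<rho> T"
    unfolding equivariant_map_def linear_map_on_def
  proof (intro conjI ballI allI)
    fix v assume v: "v \<in> W"
    then have vV: "v \<in> V" using W(2) by blast
    show "T v \<in> X" using T vV by blast
    show "T (s c v) = s c (T v)" for c
    proof (rule uniq)
      show "F (s c v) y = B (s c (T v)) y" if "y \<in> X" for y
        using that vV T[OF vV] X(2) Fl(2)[OF vV vV, of y] Bl(2)[of "T v" "T v" y]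
        by (simp add: subset_eq)
    qed (use vV T V.subspace_V X.subspace_V V.subspace_scale in blast)+
    show "T (v + w) = T v + T w" if w: "w \<in> W" for w
    proof (rule uniq)
      have wV: "w \<in> V" using w W(2) by blast
      then show "v + w \<in> V" "T v + T w \<in> X"
        using vV T V.subspace_V X.subspace_V V.subspace_add by blast+
      show "F (v + w) y = B (T v + T w) y" if "y \<in> X" for y
        using that vV wV T[OF vV] T[OF wV] X(2) Fl(1)[OF vV wV, of y] Bl(1)[of "T v" "T w" y]
        by (simp add: subset_eq)
    qed
    show "T (\<rho> g v) = \<rho> g (T v)" if g: "g \<in> carrier G" for g
    proof (rule uniq)
      show "\<rho> g v \<in> V" "\<rho> g (T v) \<in> X"
        using g vV V.act_closed X.act_closed T by blast+
      fix y assume y: "y \<in> X"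
      \<comment> \<open>Writing \<open>y\<close> as a \<open>g\<close>-translate lets the invariance
        of \<open>F\<close> remove \<open>g\<close> and that of \<open>B\<close> put it
        back.\<close>
      define y' where "y' = \<rho> (inv\<^bsub>G\<^esub> g) y"
      have y': "y' \<in> X" "\<rho> g y' = y"
        unfolding y'_def using g y X.act_closed X.act_inv_act by auto
      have "F (\<rho> g v) (\<rho> g y') = F v y'"
        using F(2) g vV y' X(2) unfolding invariant_form_def by blast
      also have "\<dots> = B (T v) y'"
        using T vV y' by blast
      also have "\<dots> = B (\<rho> g (T v)) (\<rho> g y')"
        using B(2) g T(1)[OF vV] y'(1) X(2) unfolding invariant_form_def by (simp add: subset_eq)
      finally show "F (\<rho> g v) y = B (\<rho> g (T v)) y"
        by (simp add: y')
    qed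
  qed
  then have "T w = 0"
    using schur[OF W(1) X(1)] niso wx by blast
  have wV: "w \<in> V" "x \<in> V" "0 \<in> V"
    using wx W(2) X(2) V.subspace_0[OF V.subspace_V] by auto
  have "B 0 x = 0"
    using Bl(2)[OF wV(3,3,2), of 0] by simp
  then show ?thesis
    using T(2)[OF wV(1) wx(2)] \<open>T w = 0\<close> by simp
qed

section \<open>The orthogonal sum of isotypic components\<close>

context semisimple_module
begin

text \<open>The sets \<open>A i\<close> partition the index set of the irreducible summands: a
  summand of two types would make two of the given modules isomorphic, and the projection to a
  summand of none of the types would vanish on the span of the components, that is, on
  \<open>V\<close>. Each component collects the summands of its block.\<close>

lemma isotypic_components_direct_sum:
  assumes fin: "finite T" and U: "\<And>i. i \<in> T \<Longrightarrow> irreducible_module G s' U (\<sigma> i)"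
    and niso: "\<And>i k. i \<in> T \<Longrightarrow> k \<in> T \<Longrightarrow> i \<noteq> k \<Longrightarrow> \<not> module_isomorphic G s' U (\<sigma> i) s' U (\<sigma> k)"
    and span: "span (\<Union>i\<in>T. isotypic_component G scale V \<rho> s' U (\<sigma> i)) = V"
  shows "internal_direct_sum scale V T (\<lambda>i. isotypic_component G scale V \<rho> s' U (\<sigma> i))"
proof -
  define A where "A i = {j \<in> J. module_isomorphic G scale (W j) \<rho> s' U (\<sigma> i)}" for i
  define C where "C i = isotypic_component G scale V \<rho> s' U (\<sigma> i)" for i
  have C: "C i = {v \<in> V. \<forall>j\<in>J - A i. \<pi> j v = 0}" if "i \<in> T" for i
    unfolding C_def A_def isotypic_component_eq[OF U[OF that]] by auto
  have sub: "subspace (C i)" for i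
    unfolding C_def isotypic_component_def by (rule subspace_span)
  have CV: "C i \<subseteq> V" for i
    unfolding C_def by (rule isotypic_component_subset) (rule group_module_axioms)
  have disj: "A i \<inter> A k = {}" if ik: "i \<in> T" "k \<in> T" "i \<noteq> k" for i k
  proof (rule ccontr)
    assume "A i \<inter> A k \<noteq> {}"
    then obtain j where j: "j \<in> J" "module_isomorphic G scale (W j) \<rho> s' U (\<sigma> i)"
      "module_isomorphic G scale (W j) \<rho> s' U (\<sigma> k)"
      by (auto simp: A_def)
    have "group_module G scale (W j) \<rho>"
      using irreducible_W[OF j(1)] by (simp add: irreducible_module_def)
    then show False
      using niso[OF ik] module_isomorphic_trans[OF module_isomorphic_sym[OF _ j(2)] j(3)] by blast
  qed
  have AJ: "(\<Union>i\<in>T. A i) = J"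
  proof
    show "J \<subseteq> (\<Union>i\<in>T. A i)"
    proof (rule ccontr)
      assume "\<not> J \<subseteq> (\<Union>i\<in>T. A i)"
      then obtain j where j: "j \<in> J" "\<And>i. i \<in> T \<Longrightarrow> j \<notin> A i"
        by blast
      have "span (\<Union>i\<in>T. C i) \<subseteq> {v \<in> V. \<pi> j v = 0}"
      proof (rule span_minimal)
        show "(\<Union>i\<in>T. C i) \<subseteq> {v \<in> V. \<pi> j v = 0}"
          using j C by auto
        show "subspace {v \<in> V. \<pi> j v = 0}"
          using subspace_V linear_\<pi>[OF j(1)] \<pi>_0[OF j(1)]
          unfolding subspace_def linear_map_on_def by auto
      qed
      then have z: "\<pi> j v = 0" if "v \<in> V" for v
        using span that unfolding C_def by blast
      have "w = 0" if "w \<in> W j" for w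
        using z[of w] \<pi>_of_W[OF j(1) j(1) that] W_subset[OF j(1)] that by auto
      then have "W j = {0}"
        using subspace_0[OF subspace_W[OF j(1)]] by blast
      then show False
        using irreducible_W[OF j(1)] by (simp add: irreducible_module_def)
    qed
  qed (auto simp: A_def)
  have "V = {\<Sum>i\<in>T. x i | x. \<forall>i\<in>T. x i \<in> C i}"
  proof safe
    fix v assume v: "v \<in> V"
    define x where "x i = (\<Sum>j\<in>A i. \<pi> j v)" for i
    have "(\<Sum>i\<in>T. x i) = (\<Sum>j\<in>(\<Union>i\<in>T. A i). \<pi> j v)"
      unfolding x_def using fin finite_J disj
      by (intro sum.UNION_disjoint[symmetric]) (auto simp: A_def)
    then have "v = (\<Sum>i\<in>T. x i)"
      using sum_\<pi>[OF v] AJ by simp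
    moreover have "x i \<in> C i" if i: "i \<in> T" for i
      unfolding x_def
    proof (rule subspace_sum[OF sub])
      fix j assume j: "j \<in> A i"
      then have jJ: "j \<in> J" by (simp add: A_def)
      show "\<pi> j v \<in> C i"
        using j jJ \<pi>_in_W[OF jJ v] W_subset[OF jJ] \<pi>_of_W[OF _ jJ \<pi>_in_W[OF jJ v]]
        by (auto simp: C[OF i])
    qed
    ultimately show "\<exists>x. v = (\<Sum>i\<in>T. x i) \<and> (\<forall>i\<in>T. x i \<in> C i)"
      by blast
  next
    fix x assume "\<forall>i\<in>T. x i \<in> C i"
    then show "(\<Sum>i\<in>T. x i) \<in> V"
      using CV by (intro subspace_sum subspace_V) blast
  qed
  moreover have "x i = 0"
    if x: "\<forall>i\<in>T. x i \<in> C i" and sum: "(\<Sum>i\<in>T. x i) = 0" and i: "i \<in> T" for x i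
  proof -
    have xV: "x k \<in> V" if "k \<in> T" for k
      using x CV that by blast
    \<comment> \<open>For \<open>j\<close> in the block \<open>A i\<close> only \<open>x i\<close>
      contributes to coordinate \<open>j\<close> of the zero sum; for other \<open>j\<close> the
      coordinate vanishes because \<open>x i\<close> lies in \<open>C i\<close>.\<close>
    have "\<pi> j (x i) = 0" if j: "j \<in> J" for j
    proof (cases "j \<in> A i")
      case True
      have "0 = \<pi> j (\<Sum>k\<in>T. x k)"
        using sum \<pi>_0[OF j] by simp
      also have "\<dots> = (\<Sum>k\<in>T. \<pi> j (x k))"
        using xV by (intro linear_map_on_sum[OF linear_\<pi>[OF j] subspace_V])
      also have "\<dots> = (\<Sum>k\<in>T. if k = i then \<pi> j (x i) else 0)"
      proof (rule sum.cong[OF refl])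
        fix k assume k: "k \<in> T"
        show "\<pi> j (x k) = (if k = i then \<pi> j (x i) else 0)"
        proof (cases "k = i")
          case False
          then have "j \<notin> A k"
            using disj[OF k i] True by blast
          then show ?thesis
            using False x k j C[OF k] by auto
        qed simp
      qed
      also have "\<dots> = \<pi> j (x i)"
        using fin i by simp
      finally show ?thesis ..
    next
      case False
      then show ?thesis
        using x i j C[OF i] by auto
    qed
    then show ?thesis
      using sum_\<pi>[OF xV[OF i]] by simp
  qed
  ultimately show ?thesis
    using fin sub unfolding internal_direct_sum_def C_def by blast
qed

text \<open>Both arguments are expanded into coordinates. A term with nonzero coordinates pairs a
  summand isomorphic to \<open>U\<close> with one isomorphic to \<open>X\<close>, and these two are
  not isomorphic.\<close>

lemma isotypic_components_orthogonal:
  assumes U: "irreducible_module G s' U \<sigma>" and X: "irreducible_module G s'' X \<tau>"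
    and niso: "\<not> module_isomorphic G s' U \<sigma> s'' X \<tau>"
    and S: "finite S" "span S = V"
    and B: "symmetric_bilinear_form scale V B" "invariant_form G V \<rho> B"
      "\<And>v. v \<in> V \<Longrightarrow> B v v = 0 \<Longrightarrow> v = 0"
    and F: "symmetric_bilinear_form scale V F" "invariant_form G V \<rho> F"
    and v: "v \<in> isotypic_component G scale V \<rho> s' U \<sigma>"
    and w: "w \<in> isotypic_component G scale V \<rho> s'' X \<tau>"
  shows "F v w = 0"
proof -
  have vV: "v \<in> V" and wV: "w \<in> V"
    using v w isotypic_component_subset[OF group_module_axioms] by blast+
  have \<pi>V: "\<pi> j u \<in> V" if "j \<in> J" "u \<in> V" for j u
    using \<pi>_in_W[OF that] W_subset[OF that(1)] by blast
  have lin: "linear_map_on scale V (*) (\<lambda>v. F v u)" "linear_map_on scale V (*) (F u)" if "u \<in> V" for u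
    using F(1) that unfolding symmetric_bilinear_form_def by auto
  have zero: "F 0 u = 0" "F u 0 = 0" if "u \<in> V" for u
    using linear_map_on_sum[OF lin(1)[OF that] subspace_V, of "{}"]
      linear_map_on_sum[OF lin(2)[OF that] subspace_V, of "{}"] by simp_all
  have "F (\<pi> j v) (\<pi> l w) = 0" if jl: "j \<in> J" "l \<in> J" for j l
  proof (cases "module_isomorphic G scale (W j) \<rho> s' U \<sigma> \<and> module_isomorphic G scale (W l) \<rho> s'' X \<tau>")
    case True
    have gm: "group_module G scale (W j) \<rho>" "group_module G scale (W l) \<rho>"
      using irreducible_W jl by (simp_all add: irreducible_module_def)
    have "\<not> module_isomorphic G scale (W j) \<rho> scale (W l) \<rho>"
    proof
      assume "module_isomorphic G scale (W j) \<rho> scale (W l) \<rho>"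
      then have "module_isomorphic G scale (W j) \<rho> s'' X \<tau>"
        using True module_isomorphic_trans by blast
      then have "module_isomorphic G s' U \<sigma> s'' X \<tau>"
        using True module_isomorphic_trans module_isomorphic_sym[OF gm(1)] by blast
      then show False
        using niso by blast
    qed
    then show ?thesis
      using irreducible_submodules_orthogonal[OF group_module_axioms irreducible_W[OF jl(1)]
          W_subset[OF jl(1)] irreducible_W[OF jl(2)] W_subset[OF jl(2)] _ S B F]
        \<pi>_in_W[OF jl(1) vV] \<pi>_in_W[OF jl(2) wV] by blast
  next
    case False
    then have "\<pi> j v = 0 \<or> \<pi> l w = 0"
      using v w jl unfolding isotypic_component_eq[OF U] isotypic_component_eq[OF X] by blast
    then show ?thesis
      using zero \<pi>V jl vV wV by auto
  qed
  moreover have "F v w = (\<Sum>j\<in>J. \<Sum>l\<in>J. F (\<pi> j v) (\<pi> l w))"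
  proof -
    have "F v w = F (\<Sum>j\<in>J. \<pi> j v) w"
      using sum_\<pi>[OF vV] by simp
    also have "\<dots> = (\<Sum>j\<in>J. F (\<pi> j v) w)"
      using \<pi>V vV by (intro linear_map_on_sum[OF lin(1)[OF wV] subspace_V])
    also have "\<dots> = (\<Sum>j\<in>J. \<Sum>l\<in>J. F (\<pi> j v) (\<pi> l w))"
    proof (rule sum.cong[OF refl])
      fix j assume j: "j \<in> J"
      have "F (\<pi> j v) w = F (\<pi> j v) (\<Sum>l\<in>J. \<pi> l w)"
        using sum_\<pi>[OF wV] by simp
      also have "\<dots> = (\<Sum>l\<in>J. F (\<pi> j v) (\<pi> l w))"
        using \<pi>V wV by (intro linear_map_on_sum[OF lin(2)[OF \<pi>V[OF j vV]] subspace_V])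
      finally show "F (\<pi> j v) w = (\<Sum>l\<in>J. F (\<pi> j v) (\<pi> l w))" .
    qed
    finally show ?thesis .
  qed
  ultimately show ?thesis
    by simp
qed

end

text \<open>A vector orthogonal to its own summand is orthogonal to the other summands anyway, hence
  to all of \<open>V\<close>.\<close>

lemma (in vector_space) nondegenerate_form_summand:
  assumes dec: "orthogonal_decomposition scale V F J W" and V: "subspace V"
    and F: "symmetric_bilinear_form scale V F" "nondegenerate_form V F"
    and i: "i \<in> J" and WV: "\<And>j. j \<in> J \<Longrightarrow> W j \<subseteq> V"
  shows "nondegenerate_form (W i) F"
  unfolding nondegenerate_form_def
proof (intro ballI impI)
  fix v assume v: "v \<in> W i" "\<forall>w\<in>W i. F v w = 0"
  have vV: "v \<in> V"
    using v WV i by blast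
  have "F v w = 0" if w: "w \<in> V" for w
  proof -
    obtain x where x: "w = (\<Sum>j\<in>J. x j)" "\<And>j. j \<in> J \<Longrightarrow> x j \<in> W j"
      using dec w unfolding orthogonal_decomposition_def internal_direct_sum_def by auto
    have "linear_map_on scale V (*) (F v)"
      using F(1) vV unfolding symmetric_bilinear_form_def by auto
    then have "F v w = (\<Sum>j\<in>J. F v (x j))"
      unfolding x(1) using x(2) WV by (intro linear_map_on_sum[OF _ V]) auto
    also have "\<dots> = 0"
    proof (rule sum.neutral, rule ballI)
      fix j assume j: "j \<in> J"
      show "F v (x j) = 0"
        using dec i j v x(2)[OF j] unfolding orthogonal_decomposition_def by (cases "i = j") auto
    qed
    finally show ?thesis .
  qed
  then show "v = 0"
    using F(2) vV unfolding nondegenerate_form_def by blast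
qed

section \<open>Restriction to a normal subgroup\<close>

lemma (in group) inv_cancel:
  assumes "g \<in> carrier G" "x \<in> carrier G"
  shows "g \<otimes> (inv g \<otimes> x) = x" "inv g \<otimes> (g \<otimes> x) = x"
  using assms by (simp_all flip: m_assoc)

locale normal_restriction = group_module G scale V \<rho> + normal N G
  for G :: "('g, 'x) monoid_scheme" (structure)
    and scale :: "'k::field \<Rightarrow> 'v::ab_group_add \<Rightarrow> 'v" and V \<rho> N
begin

lemma group_restrict: "group (G\<lparr>carrier := N\<rparr>)"
  by (rule subgroup_imp_group) (rule subgroup_axioms)

lemma group_module_restrict: "group_module (G\<lparr>carrier := N\<rparr>) scale V \<rho>"
proof -
  interpret N: group "G\<lparr>carrier := N\<rparr>" by (rule group_restrict)
  show ?thesis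
    by unfold_locales
      (auto intro: subspace_V act_closed act_add act_scale act_one act_mult)
qed

section \<open>Conjugate modules\<close>

lemma conj_action_module:
  assumes U: "group_module (G\<lparr>carrier := N\<rparr>) s' U \<tau>" and g: "g \<in> carrier G"
  shows "group_module (G\<lparr>carrier := N\<rparr>) s' U (conj_action G g \<tau>)"
proof -
  interpret U: group_module "G\<lparr>carrier := N\<rparr>" s' U \<tau> by fact
  have "inv g \<otimes> (n \<otimes> n') \<otimes> g = (inv g \<otimes> n \<otimes> g) \<otimes> (inv g \<otimes> n' \<otimes> g)" if "n \<in> N" "n' \<in> N" for n n'
    using that g by (simp add: m_assoc inv_cancel)
  then show ?thesis
    using U.act_closed U.act_add U.act_scale U.act_one U.act_mult U.subspace_V g
    by unfold_locales (auto simp: conj_action_def inv_op_closed1)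
qed

text \<open>Conjugation is a left action of the group on modules over \<open>N\<close>. The actions
  agree only at elements of \<open>N\<close>, so later uses pass to an isomorphism by
  \<open>module_isomorphic_cong_action\<close>.\<close>

lemma conj_action_conj:
  assumes "g \<in> carrier G" "h \<in> carrier G" "n \<in> N"
  shows "conj_action G g (conj_action G h \<tau>) n = conj_action G (g \<otimes> h) \<tau> n"
  using assms by (simp add: conj_action_def inv_mult_group m_assoc)

lemma conj_action_one: "n \<in> N \<Longrightarrow> conj_action G \<one> \<tau> n = \<tau> n"
  by (simp add: conj_action_def)

lemma conj_action_isomorphic_cong:
  assumes "module_isomorphic (G\<lparr>carrier := N\<rparr>) s' U \<sigma> s'' X \<tau>" and "g \<in> carrier G"
  shows "module_isomorphic (G\<lparr>carrier := N\<rparr>) s' U (conj_action G g \<sigma>) s'' X (conj_action G g \<tau>)"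
proof -
  obtain f where "linear_map_on s' U s'' f" "bij_betw f U X"
    and f: "\<And>n u. n \<in> N \<Longrightarrow> u \<in> U \<Longrightarrow> f (\<sigma> n u) = \<tau> n (f u)"
    using assms(1) unfolding module_isomorphic_def by auto
  moreover have "f (conj_action G g \<sigma> n u) = conj_action G g \<tau> n (f u)" if "n \<in> N" "u \<in> U" for n u
    unfolding conj_action_def using f inv_op_closed1[OF assms(2)] that by blast
  ultimately show ?thesis
    unfolding module_isomorphic_def by auto
qed

text \<open>Conjugation by \<open>g\<close> maps \<open>N\<close> onto itself, so the conjugate
  action uses the same operators in another order and has the same invariant subspaces.\<close>

lemma conj_action_irreducible:
  assumes U: "irreducible_module (G\<lparr>carrier := N\<rparr>) s' U \<tau>" and g: "g \<in> carrier G"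
  shows "irreducible_module (G\<lparr>carrier := N\<rparr>) s' U (conj_action G g \<tau>)"
proof -
  have gmU: "group_module (G\<lparr>carrier := N\<rparr>) s' U \<tau>"
    using U by (simp add: irreducible_module_def)
  then interpret U: group_module "G\<lparr>carrier := N\<rparr>" s' U \<tau> .
  have "X = {0} \<or> X = U"
    if X: "X \<subseteq> U" "group_module (G\<lparr>carrier := N\<rparr>) s' X (conj_action G g \<tau>)" for X
  proof -
    interpret X: group_module "G\<lparr>carrier := N\<rparr>" s' X "conj_action G g \<tau>" by fact
    have "\<tau> n x \<in> X" if "n \<in> N" "x \<in> X" for n x
    proof -
      have "g \<otimes> n \<otimes> inv g \<in> N"
        using that g by (intro inv_op_closed2)
      then have "conj_action G g \<tau> (g \<otimes> n \<otimes> inv g) x \<in> X"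
        using X.act_closed that by simp
      moreover have "inv g \<otimes> (g \<otimes> n \<otimes> inv g) \<otimes> g = n"
        using that g by (simp add: m_assoc inv_cancel)
      ultimately show ?thesis
        by (simp add: conj_action_def)
    qed
    then have "group_module (G\<lparr>carrier := N\<rparr>) s' X \<tau>"
      using X by (intro U.submoduleI X.subspace_V) auto
    then show ?thesis
      using U X(1) by (simp add: irreducible_module_def)
  qed
  then show ?thesis
    using U conj_action_module[OF gmU g] unfolding irreducible_module_def by simp
qed

section \<open>The action of the group on submodules over \<open>N\<close>\<close>

lemma act_image_module:
  assumes X: "group_module (G\<lparr>carrier := N\<rparr>) scale X \<rho>" "X \<subseteq> V" and h: "h \<in> carrier G"
  shows "group_module (G\<lparr>carrier := N\<rparr>) scale (\<rho> h ` X) \<rho>"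
proof -
  interpret X: group_module "G\<lparr>carrier := N\<rparr>" scale X \<rho> by fact
  interpret R: group_module "G\<lparr>carrier := N\<rparr>" scale V \<rho> by (rule group_module_restrict)
  have XV: "\<And>x. x \<in> X \<Longrightarrow> x \<in> V"
    using X by blast
  show ?thesis
  proof (rule R.submoduleI)
    show "\<rho> h ` X \<subseteq> V"
      using XV h act_closed by auto
    show "subspace (\<rho> h ` X)"
      unfolding subspace_def
    proof (intro conjI ballI allI)
      show "0 \<in> \<rho> h ` X"
        using act_0[OF h] subspace_0[OF X.subspace_V] by force
      show "x + y \<in> \<rho> h ` X" if "x \<in> \<rho> h ` X" "y \<in> \<rho> h ` X" for x y
        using that subspace_add[OF X.subspace_V] XV h by (auto simp flip: act_add)
      show "scale c x \<in> \<rho> h ` X" if "x \<in> \<rho> h ` X" for c x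
        using that subspace_scale[OF X.subspace_V] XV h by (auto simp flip: act_scale)
    qed
    fix n y assume n: "n \<in> carrier (G\<lparr>carrier := N\<rparr>)" and "y \<in> \<rho> h ` X"
    then obtain x where x: "x \<in> X" "y = \<rho> h x" by blast
    have nN: "n \<in> N" "n \<in> carrier G" using n by auto
    have "\<rho> n y = \<rho> (n \<otimes> h) x"
      using x XV h nN by (simp add: act_mult)
    \<comment> \<open>Normality brings the conjugated factor back into \<open>N\<close>, under which
      \<open>X\<close> is invariant.\<close>
    also have "n \<otimes> h = h \<otimes> (inv h \<otimes> n \<otimes> h)"
      using h nN by (simp add: m_assoc inv_cancel)
    also have "\<rho> \<dots> x = \<rho> h (\<rho> (inv h \<otimes> n \<otimes> h) x)"
      using x XV h nN by (intro act_mult) auto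
    finally show "\<rho> n y \<in> \<rho> h ` X"
      using x X.act_closed inv_op_closed1[OF h nN(1)] by auto
  qed
qed

text \<open>The isomorphism goes back to \<open>X\<close> by the inverse of \<open>h\<close> and
  then to \<open>Y\<close>; moving the inverse of \<open>h\<close> past \<open>n\<close> produces
  exactly the conjugate of \<open>n\<close> in \<open>conj_action\<close>.\<close>

lemma act_image_isomorphic:
  assumes X: "X \<subseteq> V" and h: "h \<in> carrier G"
    and iso: "module_isomorphic (G\<lparr>carrier := N\<rparr>) scale X \<rho> s' Y \<tau>"
  shows "module_isomorphic (G\<lparr>carrier := N\<rparr>) scale (\<rho> h ` X) \<rho> s' Y (conj_action G h \<tau>)"
proof -
  have XV: "\<And>x. x \<in> X \<Longrightarrow> x \<in> V"
    using X by blast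
  obtain f where f: "linear_map_on scale X s' f" "bij_betw f X Y"
    "\<And>n x. n \<in> N \<Longrightarrow> x \<in> X \<Longrightarrow> f (\<rho> n x) = \<tau> n (f x)"
    using iso unfolding module_isomorphic_def by auto
  have bij: "bij_betw (\<rho> (inv h)) (\<rho> h ` X) X"
    by (rule bij_betw_byWitness[of _ "\<rho> h"]) (use XV h act_inv_act in \<open>auto simp: image_iff\<close>)
  have "linear_map_on scale (\<rho> h ` X) s' (f \<circ> \<rho> (inv h))"
    using f(1) h XV act_closed act_add[of "inv h"] act_scale[of "inv h"]
    unfolding linear_map_on_def by (auto simp: act_inv_act)
  moreover have "(f \<circ> \<rho> (inv h)) (\<rho> n y) = conj_action G h \<tau> n ((f \<circ> \<rho> (inv h)) y)"
    if n: "n \<in> N" and y: "y \<in> \<rho> h ` X" for n y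
  proof -
    obtain x where x: "x \<in> X" "y = \<rho> h x" using y by blast
    have "\<rho> (inv h) (\<rho> n y) = \<rho> (inv h \<otimes> n \<otimes> h) x"
      using x XV h n by (simp add: act_mult act_closed)
    then show ?thesis
      using x XV h n f(3)[OF inv_op_closed1] by (simp add: conj_action_def act_inv_act)
  qed
  ultimately show ?thesis
    unfolding module_isomorphic_def using bij_betw_trans[OF bij f(2)] by auto
qed

text \<open>The generating submodules of one component are mapped to generating submodules of the
  other, and the preimage of a subspace is a subspace.\<close>

lemma act_isotypic_component_subset:
  assumes h: "h \<in> carrier G"
  shows "\<rho> h ` isotypic_component (G\<lparr>carrier := N\<rparr>) scale V \<rho> s' U \<tau>
    \<subseteq> isotypic_component (G\<lparr>carrier := N\<rparr>) scale V \<rho> s' U (conj_action G h \<tau>)" (is "_ ` ?C \<subseteq> ?D")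
proof -
  have D: "subspace ?D"
    unfolding isotypic_component_def by (rule subspace_span)
  have "?C \<subseteq> {v \<in> V. \<rho> h v \<in> ?D}"
    unfolding isotypic_component_def[of _ _ _ _ _ _ \<tau>]
  proof (rule span_minimal, safe)
    fix X x assume X: "X \<subseteq> V" "group_module (G\<lparr>carrier := N\<rparr>) scale X \<rho>"
      "module_isomorphic (G\<lparr>carrier := N\<rparr>) scale X \<rho> s' U \<tau>" and x: "x \<in> X"
    show "x \<in> V" using X x by blast
    have "\<rho> h ` X \<subseteq> V"
      using X(1) h act_closed by blast
    then show "\<rho> h x \<in> ?D"
      unfolding isotypic_component_def
      using act_image_module[OF X(2,1) h] act_image_isomorphic[OF X(1) h X(3)] x
      by (intro span_base) blast
  next
    show "subspace {v \<in> V. \<rho> h v \<in> ?D}"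
      using subspace_V D h unfolding subspace_def by (auto simp: act_0 act_add act_scale)
  qed
  then show ?thesis by blast
qed

lemma act_isotypic_component:
  assumes U: "group_module (G\<lparr>carrier := N\<rparr>) s' U \<tau>" and h: "h \<in> carrier G"
  shows "\<rho> h ` isotypic_component (G\<lparr>carrier := N\<rparr>) scale V \<rho> s' U \<tau>
    = isotypic_component (G\<lparr>carrier := N\<rparr>) scale V \<rho> s' U (conj_action G h \<tau>)" (is "_ ` ?C = ?D")
proof
  show "?D \<subseteq> \<rho> h ` ?C"
  proof
    fix v assume v: "v \<in> ?D"
    \<comment> \<open>The reverse inclusion is the proved one for the inverse of \<open>h\<close>,
      applied to the conjugate module; conjugating back gives a module isomorphic to
      \<open>U\<close>.\<close>
    have "module_isomorphic (G\<lparr>carrier := N\<rparr>) s' U \<tau>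
        s' U (conj_action G (inv h) (conj_action G h \<tau>))"
      using h by (intro module_isomorphic_cong_action) (simp add: conj_action_conj conj_action_one)
    then have "?C = isotypic_component (G\<lparr>carrier := N\<rparr>) scale V \<rho> s' U
        (conj_action G (inv h) (conj_action G h \<tau>))"
      by (rule isotypic_component_cong[OF U])
    then have "\<rho> (inv h) v \<in> ?C"
      using act_isotypic_component_subset[of "inv h" s' U "conj_action G h \<tau>"] h v by blast
    moreover have "v \<in> V"
      using v isotypic_component_subset[OF group_module_restrict] by blast
    ultimately show "v \<in> \<rho> h ` ?C"
      using act_inv_act(2)[OF h] by (metis image_eqI)
  qed
qed (rule act_isotypic_component_subset[OF h])

text \<open>Conjugating the given isomorphism by the inverse of \<open>h\<close> compares a
  conjugate of \<open>U\<close> with \<open>U\<close> itself. Hence conjugates from different cosets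
  of the inertia group are not isomorphic.\<close>

lemma conj_action_isomorphicD:
  assumes g: "g \<in> carrier G" "h \<in> carrier G"
    and iso: "module_isomorphic (G\<lparr>carrier := N\<rparr>) s' U (conj_action G g \<tau>) s' U (conj_action G h \<tau>)"
  shows "inv h \<otimes> g \<in> inertia_group G N s' U \<tau>"
proof -
  have "module_isomorphic (G\<lparr>carrier := N\<rparr>) s' U (conj_action G (inv h \<otimes> g) \<tau>)
      s' U (conj_action G (inv h) (conj_action G g \<tau>))"
    using g by (intro module_isomorphic_cong_action) (simp add: conj_action_conj)
  moreover have "module_isomorphic (G\<lparr>carrier := N\<rparr>) s' U (conj_action G (inv h) (conj_action G g \<tau>))
      s' U (conj_action G (inv h) (conj_action G h \<tau>))"
    using g iso by (intro conj_action_isomorphic_cong) auto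
  moreover have "module_isomorphic (G\<lparr>carrier := N\<rparr>) s' U
      (conj_action G (inv h) (conj_action G h \<tau>)) s' U \<tau>"
    using g by (intro module_isomorphic_cong_action) (simp add: conj_action_conj conj_action_one)
  ultimately show ?thesis
    using g module_isomorphic_trans unfolding inertia_group_def by blast
qed

text \<open>The isomorphism class of a conjugate depends only on the left coset of the conjugating
  element, so coset representatives give all conjugates.\<close>

lemma conj_action_inertia_isomorphic:
  assumes g: "g \<in> carrier G" and x: "x \<in> inertia_group G N s' U \<tau>"
  shows "module_isomorphic (G\<lparr>carrier := N\<rparr>) s' U (conj_action G (g \<otimes> x) \<tau>) s' U (conj_action G g \<tau>)"
proof -
  have x': "x \<in> carrier G" "module_isomorphic (G\<lparr>carrier := N\<rparr>) s' U (conj_action G x \<tau>) s' U \<tau>"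
    using x by (auto simp: inertia_group_def)
  have "module_isomorphic (G\<lparr>carrier := N\<rparr>) s' U (conj_action G (g \<otimes> x) \<tau>)
      s' U (conj_action G g (conj_action G x \<tau>))"
    using g x' by (intro module_isomorphic_cong_action) (simp add: conj_action_conj)
  then show ?thesis
    using conj_action_isomorphic_cong[OF x'(2) g] module_isomorphic_trans by blast
qed

lemma one_in_inertia_group: "\<one> \<in> inertia_group G N s' U \<tau>"
  unfolding inertia_group_def
  by (auto intro!: module_isomorphic_cong_action simp: conj_action_one)

end

section \<open>Transitive permutation of the components by isometries\<close>

theorem lemma3p9:
  fixes G :: "('g, 'x) monoid_scheme" (structure)
    and sV :: "'k::field_char_0 \<Rightarrow> 'v::ab_group_add \<Rightarrow> 'v" and V :: "'v set"
    and \<rho> :: "'g \<Rightarrow> 'v \<Rightarrow> 'v" and F :: "'v \<Rightarrow> 'v \<Rightarrow> 'k"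
    and sU :: "'k \<Rightarrow> 'u::ab_group_add \<Rightarrow> 'u" and U :: "'u set"
    and \<tau> :: "'g \<Rightarrow> 'u \<Rightarrow> 'u"
    and N I :: "'g set" and e t :: nat and g :: "nat \<Rightarrow> 'g" and Vc :: "nat \<Rightarrow> 'v set"
  assumes "group G" and "finite (carrier G)"
    and "number_field TYPE('k)" and "totally_real TYPE('k)"
    and "irreducible_module G sV V \<rho>"
    and "symmetric_bilinear_form sV V F" and "invariant_form G V \<rho> F"
    and "nondegenerate_form V F"
    and "N \<lhd> G"
    and "irreducible_module (G\<lparr>carrier := N\<rparr>) sU U \<tau>"
    and "has_multiplicity (G\<lparr>carrier := N\<rparr>) sV V \<rho> sU U \<tau> e" and "e > 0"
    and "I = inertia_group G N sU U \<tau>"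
    and "t = card (rcosets I)"
    and "\<forall>i\<in>{1..t}. g i \<in> carrier G"
    and "carrier G = (\<Union>i\<in>{1..t}. g i <# I)"
    and "disjoint_family_on (\<lambda>i. g i <# I) {1..t}"
    and "\<forall>i\<in>{1..t}. Vc i =
      isotypic_component (G\<lparr>carrier := N\<rparr>) sV V \<rho> sU U (conj_action G (g i) \<tau>)"
  shows "(\<forall>i\<in>{1..t}. group_module (G\<lparr>carrier := N\<rparr>) sV (Vc i) \<rho> \<and>
            module_isomorphic (G\<lparr>carrier := N\<rparr>) sV (Vc i) \<rho>
              (power_scale sU) (power_space e U) (power_action e (conj_action G (g i) \<tau>))) \<and>
         (\<forall>i\<in>{1..t}. \<forall>j\<in>{1..t}. i \<noteq> j \<longrightarrow>
            \<not> module_isomorphic (G\<lparr>carrier := N\<rparr>)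
                sU U (conj_action G (g i) \<tau>) sU U (conj_action G (g j) \<tau>)) \<and>
         orthogonal_decomposition sV V F {1..t} Vc \<and>
         (\<forall>i\<in>{1..t}. nondegenerate_form (Vc i) F) \<and>
         (\<forall>i\<in>{1..t}. \<forall>j\<in>{1..t}. isometric sV (Vc i) F sV (Vc j) F)"
proof -
  note V = assms(5) and F = assms(6-8) and U = assms(10) and I = assms(13) and Vc = assms(18)
  let ?H = "G\<lparr>carrier := N\<rparr>"
  let ?C = "isotypic_component ?H sV V \<rho> sU U"
  interpret group_module G sV V \<rho>
    using V by (simp add: irreducible_module_def)
  interpret normal N G by fact
  interpret R: normal_restriction G sV V \<rho> N ..
  have g: "g i \<in> carrier G" if "i \<in> {1..t}" for i
    using assms(15) that by blast
  have gmU: "group_module ?H sU U \<tau>"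
    using U by (simp add: irreducible_module_def)
  have Ui: "irreducible_module ?H sU U (conj_action G (g i) \<tau>)" if "i \<in> {1..t}" for i
    using R.conj_action_irreducible[OF U g[OF that]] .
  have gmUi: "group_module ?H sU U (conj_action G h \<tau>)" if "h \<in> carrier G" for h
    using R.conj_action_module[OF gmU that] .
  obtain m W where ds: "internal_direct_sum sV V {..<m::nat} W"
    and W: "\<And>j. j \<in> {..<m} \<Longrightarrow> irreducible_module ?H sV (W j) \<rho>"
    and e: "e = card {j \<in> {..<m}. module_isomorphic ?H sV (W j) \<rho> sU U \<tau>}"
    using assms(11) unfolding has_multiplicity_def by auto
  obtain \<pi> where "semisimple_module ?H sV V \<rho> {..<m} W \<pi>"
    using group_module.semisimple_moduleI[OF R.group_module_restrict ds W] by metis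
  then interpret W: semisimple_module ?H sV V \<rho> "{..<m}" W \<pi> .

  \<comment> \<open>An isomorphism would place \<open>g i\<close> in the coset of
    \<open>g j\<close>. It also lies in its own coset, since \<open>I\<close> contains the identity,
    which contradicts disjointness.\<close>
  have niso: "\<not> module_isomorphic ?H sU U (conj_action G (g i) \<tau>) sU U (conj_action G (g j) \<tau>)"
    if ij: "i \<in> {1..t}" "j \<in> {1..t}" "i \<noteq> j" for i j
  proof
    assume "module_isomorphic ?H sU U (conj_action G (g i) \<tau>) sU U (conj_action G (g j) \<tau>)"
    then have "inv (g j) \<otimes> g i \<in> I"
      using R.conj_action_isomorphicD g ij unfolding I by blast
    moreover have "g i = g j \<otimes> (inv (g j) \<otimes> g i)"
      using g ij by (simp add: inv_cancel)
    ultimately have "g i \<in> g j <# I"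
      unfolding l_coset_def by blast
    moreover have "g i \<otimes> \<one> \<in> g i <# I"
      using R.one_in_inertia_group unfolding l_coset_def I by blast
    then have "g i \<in> g i <# I"
      using g[OF ij(1)] by simp
    ultimately show False
      using disjoint_family_onD[OF assms(17) ij] by blast
  qed

  \<comment> \<open>The cosets cover the group, so the component of any conjugate of
    \<open>U\<close> is one of the \<open>Vc k\<close>. This makes their span invariant under the
    whole group.\<close>
  have comp: "\<exists>k\<in>{1..t}. ?C (conj_action G h \<tau>) = Vc k" if h: "h \<in> carrier G" for h
  proof -
    obtain k x where k: "k \<in> {1..t}" "x \<in> I" "h = g k \<otimes> x"
      using h assms(16) unfolding l_coset_def by blast
    have "?C (conj_action G h \<tau>) = ?C (conj_action G (g k) \<tau>)"
      using R.conj_action_inertia_isomorphic[OF g[OF k(1)]] k(2,3) gmUi[OF h] unfolding I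
      by (intro isotypic_component_cong) auto
    then show ?thesis
      using k(1) Vc by auto
  qed
  have C: "\<rho> h ` ?C \<tau> = ?C (conj_action G h \<tau>)" if "h \<in> carrier G" for h
    using R.act_isotypic_component[OF gmU that] .
  have Vc_eq: "Vc i = \<rho> (g i) ` ?C \<tau>" if "i \<in> {1..t}" for i
    using C[OF g[OF that]] Vc that by simp
  have CV: "?C \<sigma> \<subseteq> V" for \<sigma>
    using isotypic_component_subset[OF R.group_module_restrict] .
  have VcV: "Vc i \<subseteq> V" if "i \<in> {1..t}" for i
    using CV Vc that by auto

  have span: "span (\<Union>i\<in>{1..t}. Vc i) = V"
  proof -
    have sub: "(\<Union>i\<in>{1..t}. Vc i) \<subseteq> V"
      using VcV by blast
    have "group_module G sV (span (\<Union>i\<in>{1..t}. Vc i)) \<rho>"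
    proof (rule group_module_span[OF sub])
      fix h v assume h: "h \<in> carrier G" and "v \<in> (\<Union>i\<in>{1..t}. Vc i)"
      then obtain i u where i: "i \<in> {1..t}" "u \<in> ?C \<tau>" "v = \<rho> (g i) u"
        using Vc_eq by blast
      have hg: "h \<otimes> g i \<in> carrier G"
        using h g[OF i(1)] by simp
      have "\<rho> h v = \<rho> (h \<otimes> g i) u"
        using act_mult[OF h g[OF i(1)] subsetD[OF CV i(2)]] i(3) by simp
      then have "\<rho> h v \<in> ?C (conj_action G (h \<otimes> g i) \<tau>)"
        using C[OF hg] i(2) by blast
      then show "\<rho> h v \<in> span (\<Union>i\<in>{1..t}. Vc i)"
        using comp[OF hg] by (intro span_base) blast
    qed
    \<comment> \<open>Positive multiplicity gives a summand isomorphic to \<open>U\<close>. The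
      identity need not be one of the chosen representatives, so \<open>U\<close> is treated as its
      conjugate by the identity and \<open>comp\<close> locates the component.\<close>
    moreover obtain w where "w \<in> span (\<Union>i\<in>{1..t}. Vc i)" "w \<noteq> 0"
    proof -
      have "{j \<in> {..<m}. module_isomorphic ?H sV (W j) \<rho> sU U \<tau>} \<noteq> {}"
        using e \<open>e > 0\<close> by (metis card.empty less_irrefl)
      then obtain j where j: "j \<in> {..<m}" "module_isomorphic ?H sV (W j) \<rho> sU U \<tau>"
        by blast
      have one: "\<one> \<in> carrier G"
        by simp
      have Wj: "group_module ?H sV (W j) \<rho>" "W j \<noteq> {0}"
        using W[OF j(1)] by (auto simp: irreducible_module_def)
      obtain w where w: "w \<in> W j" "w \<noteq> 0"
        using Wj subspace_0[OF W.subspace_W[OF j(1)]] by blast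
      have "w \<in> ?C \<tau>"
        unfolding isotypic_component_def using Wj(1) j w W.W_subset by (intro span_base) blast
      then have "\<rho> \<one> w \<in> ?C (conj_action G \<one> \<tau>)"
        using C[OF one] by blast
      moreover have "\<rho> \<one> w = w"
        using w W.W_subset[OF j(1)] by (intro act_one) blast
      ultimately have "w \<in> span (\<Union>i\<in>{1..t}. Vc i)"
        using comp[OF one] by (intro span_base) auto
      then show ?thesis
        using that w by blast
    qed
    ultimately show ?thesis
      using irreducible_moduleD[OF V] span_minimal[OF sub subspace_V] by blast
  qed

  obtain S where S: "finite S" "span S = V"
    using irreducible_module_finite_span[OF V assms(2)] by metis
  have invN: "invariant_form ?H V \<rho> B" if "invariant_form G V \<rho> B" for B
    using that unfolding invariant_form_def by auto
  obtain B where B: "symmetric_bilinear_form sV V B" "invariant_form G V \<rho> B"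
    "\<And>v. v \<in> V \<Longrightarrow> B v v = 0 \<Longrightarrow> v = 0"
    using invariant_definite_form[OF assms(3,4) group_module_axioms assms(2) S] by metis

  have "internal_direct_sum sV V {1..t} (\<lambda>i. ?C (conj_action G (g i) \<tau>))"
  proof (rule W.isotypic_components_direct_sum)
    show "span (\<Union>i\<in>{1..t}. ?C (conj_action G (g i) \<tau>)) = V"
      using span Vc by simp
  qed (use Ui niso in auto)
  then have "internal_direct_sum sV V {1..t} Vc"
    using Vc unfolding internal_direct_sum_def by (simp cong: conj_cong)
  moreover have "F v w = 0" if "i \<in> {1..t}" "j \<in> {1..t}" "i \<noteq> j" "v \<in> Vc i" "w \<in> Vc j" for i j v w
    using W.isotypic_components_orthogonal[OF Ui[OF that(1)] Ui[OF that(2)] niso[OF that(1-3)]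
        S B(1) invN[OF B(2)] B(3) F(1) invN[OF F(2)]] that Vc by blast
  ultimately have orth: "orthogonal_decomposition sV V F {1..t} Vc"
    unfolding orthogonal_decomposition_def by blast

  have "group_module ?H sV (Vc i) \<rho>" if "i \<in> {1..t}" for i
    using group_module_isotypic_component[OF R.group_module_restrict] Vc that by simp
  moreover have "module_isomorphic ?H sV (Vc i) \<rho>
      (power_scale sU) (power_space e U) (power_action e (conj_action G (g i) \<tau>))"
    if i: "i \<in> {1..t}" for i
  proof -
    \<comment> \<open>The power decomposition is known for the component of \<open>U\<close>;
      \<open>g i\<close> transports it to \<open>Vc i\<close>, and conjugating the power action is
      the same as taking the power of the conjugate action.\<close>
    have "module_isomorphic ?H sV (Vc i) \<rho>
        (power_scale sU) (power_space e U) (conj_action G (g i) (power_action e \<tau>))"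
      unfolding Vc_eq[OF i]
      using R.act_image_isomorphic[OF CV g[OF i] W.isotypic_component_isomorphic_power[OF U e]] .
    then show ?thesis
      by (simp add: conj_action_def power_action_def[abs_def])
  qed
  moreover have "nondegenerate_form (Vc i) F" if "i \<in> {1..t}" for i
    using nondegenerate_form_summand[OF orth subspace_V F(1,3) that VcV] .
  moreover have "isometric sV (Vc i) F sV (Vc j) F" if ij: "i \<in> {1..t}" "j \<in> {1..t}" for i j
  proof -
    \<comment> \<open>This element carries \<open>Vc i\<close> back to the component of
      \<open>U\<close> and on to \<open>Vc j\<close>; invariance of \<open>F\<close> makes it an
      isometry.\<close>
    define h where "h = g j \<otimes> inv (g i)"
    have h: "h \<in> carrier G"
      unfolding h_def using g ij by simp
    have img: "\<rho> h ` Vc i = Vc j"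
    proof -
      have "\<rho> h (\<rho> (g i) v) = \<rho> (g j) v" if "v \<in> ?C \<tau>" for v
      proof -
        have "h \<otimes> g i = g j"
          unfolding h_def using g ij by (simp add: m_assoc)
        then show ?thesis
          using act_mult[OF h g[OF ij(1)] subsetD[OF CV that]] by simp
      qed
      then show ?thesis
        unfolding Vc_eq[OF ij(1)] Vc_eq[OF ij(2)] image_image by (rule image_cong[OF refl])
    qed
    have "inj_on (\<rho> h) V"
      using act_inv_act(1)[OF h] by (metis inj_onI)
    then have "bij_betw (\<rho> h) (Vc i) (Vc j)"
      using img VcV[OF ij(1)] by (auto simp: bij_betw_def intro: inj_on_subset)
    moreover have "linear_map_on sV (Vc i) sV (\<rho> h)"
      using linear_act[OF h] VcV[OF ij(1)] by (rule linear_map_on_subset)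
    moreover have "\<forall>v\<in>Vc i. \<forall>w\<in>Vc i. F (\<rho> h v) (\<rho> h w) = F v w"
      using F(2) h VcV[OF ij(1)] unfolding invariant_form_def by blast
    ultimately show ?thesis
      unfolding isometric_def by blast
  qed
  ultimately show ?thesis
    using niso orth by blast
qed

end
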